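(* Up to a set of zero Lebesgue measure and full Hausdorff dimension, the parameter space $[1,2]$ is divided into intervals of parameters $\eta$ on which the density of the absolutely continuous invariant measure $\mu_\eta$ of $S_\eta$ is piecewise smooth with the same number of jumps. These intervals are uniquely determined by the initial parts of the sequences $(d_{\eta,n}(1))_{n\ge1}$ for $\eta$ in the interval.
   Context: For $\eta\in[1,2]$ the symmetric doubling map $S_\eta:[-1,1]\to[-1,1]$ is $S_\eta(x)=2x-d_1(x)\eta$, where $d_1(x)=-1$ if $x<-\frac12$, $d_1(x)=0$ if $x\in[-\frac12,\frac12]$, and $d_1(x)=1$ if $x>\frac12$. For $n\ge1$ put $d_{\eta,n}(x)=d_1(S_\eta^{n-1}(x))$; thus $(d_{\eta,n}(1))_{n\ge1}$ is the digit sequence of the point $1$ under $S_\eta$. For $\eta\in(1,2]$, $\mu_\eta$ denotes the unique $S_\eta$-invariant Borel probability measure on $[-1,1]$ that is absolutely continuous with respect to Lebesgue measure. For $\eta=1$, $\mu_1$ is normalised Lebesgue measure on $[-1,1]$. The density of $\mu_\eta$ is piecewise smooth if it is smooth apart from finitely many jumps. The matching index of $S_\eta$ is $m(\eta)=\inf\{m\ge1: S_\eta^m(1)=S_\eta^m(1-\eta)\}$, with $m(\eta)=\infty$ if there is no such $m$. The intervals in the theorem are called matching intervals, and the initial part of $(d_{\eta,n}(1))_{n\ge1}$ refers to its digits up to the matching index, i.e. those with $1\le n\le m(\eta)$.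
   Formalization: The number of jumps is the same on each interval except for at most one parameter, where jumps coincide or reach the end points; the literal claim fails, e.g. on (5/4,3/2) the density has 6 jumps at η=13/10 but 4 at η=4/3. *)

theory Defs
  imports "HOL-Probability.Probability"
begin

definition d1 :: "real \<Rightarrow> int" where
  "d1 x = (if x < - 1 / 2 then - 1 else if x \<le> 1 / 2 then 0 else 1)"

definition sym_doubling :: "real \<Rightarrow> real \<Rightarrow> real" where
  "sym_doubling \<eta> x = 2 * x - of_int (d1 x) * \<eta>"

definition digit :: "real \<Rightarrow> nat \<Rightarrow> real \<Rightarrow> int" where
  "digit \<eta> n x = d1 ((sym_doubling \<eta> ^^ (n - 1)) x)"

(* In enat the infimum of the empty set is \<infinity>. *)
definition matching_index :: "real \<Rightarrow> enat" where
  "matching_index \<eta> =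
     Inf {enat m | m. 1 \<le> m \<and>
            (sym_doubling \<eta> ^^ m) 1 = (sym_doubling \<eta> ^^ m) (1 - \<eta>)}"

(* The digits of 1 with positions 1, ..., m(\<eta>); meaningful only if m(\<eta>) < \<infinity>. *)
definition initial_digits :: "real \<Rightarrow> int list" where
  "initial_digits \<eta> = map (\<lambda>n. digit \<eta> n 1) [1..<Suc (the_enat (matching_index \<eta>))]"

(* The maximal intervals of parameters with finite matching index. *)
definition matching_intervals :: "real set set" where
  "matching_intervals = components {\<eta> \<in> {1..2}. matching_index \<eta> < \<infinity>}"

abbreviation leb :: "real measure" where
  "leb \<equiv> restrict_space lborel {-1..1}"

definition acip :: "real \<Rightarrow> real measure \<Rightarrow> bool" where
  "acip \<eta> \<mu> \<longleftrightarrow>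
     prob_space \<mu> \<and> sets \<mu> = sets leb \<and>
     distr \<mu> \<mu> (sym_doubling \<eta>) = \<mu> \<and> absolutely_continuous leb \<mu>"

definition inv_measure :: "real \<Rightarrow> real measure" where
  "inv_measure \<eta> = (if \<eta> = 1 then uniform_measure leb {-1..1} else (THE \<mu>. acip \<eta> \<mu>))"

definition jump_at :: "(real \<Rightarrow> real) \<Rightarrow> real \<Rightarrow> bool" where
  "jump_at h x \<longleftrightarrow>
     (\<exists>a b. (h \<longlongrightarrow> a) (at_left x) \<and> (h \<longlongrightarrow> b) (at_right x) \<and> a \<noteq> b)"

(* Some version h of the density of \<mu> on [-1,1] is smooth apart from jumps exactly at the
   points of D. Since every point of D is a genuine jump and h is continuous elsewhere,
   \<mu> determines D. The end points -1 and 1 do not count as jumps. *)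
definition piecewise_smooth_density :: "real measure \<Rightarrow> real set \<Rightarrow> bool" where
  "piecewise_smooth_density \<mu> D \<longleftrightarrow>
     finite D \<and> D \<subseteq> {-1<..<1} \<and>
     (\<exists>h. h \<in> borel_measurable borel \<and> (\<forall>x. 0 \<le> h x) \<and>
          \<mu> = density leb (\<lambda>x. ennreal (h x)) \<and>
          continuous_on ({-1..1} - D) h \<and>
          (\<forall>k. (deriv ^^ k) h differentiable_on ({-1<..<1} - D)) \<and>
          (\<forall>x\<in>D. jump_at h x))"

definition hausdorff_pre :: "real \<Rightarrow> real \<Rightarrow> 'a::metric_space set \<Rightarrow> ennreal" where
  "hausdorff_pre s \<delta> A =
     Inf {(\<Sum>i. ennreal (diameter (U i) powr s)) | U :: nat \<Rightarrow> 'a set.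
            A \<subseteq> (\<Union>i. U i) \<and> (\<forall>i. bounded (U i) \<and> diameter (U i) \<le> \<delta>)}"

definition hausdorff_measure :: "real \<Rightarrow> 'a::metric_space set \<Rightarrow> ennreal" where
  "hausdorff_measure s A = (SUP \<delta>\<in>{0<..}. hausdorff_pre s \<delta> A)"

(* The exponent s = 0 is left out because 0 powr 0 = 0; this does not change the infimum. *)
definition hausdorff_dim :: "'a::metric_space set \<Rightarrow> ereal" where
  "hausdorff_dim A = Inf {ereal s | s. 0 < s \<and> hausdorff_measure s A = 0}"

end

theory Submission
  imports Defs
begin

text \<open>
  Write y(n) and z(n) for the images of 1 and of 1 - \<eta> after n steps, and let \<eta> > 1. At first
  y(n) - z(n) = \<eta>. This persists as long as exactly one of the two points has a nonzero digit, because
  doubling the distance is then compensated by subtracting \<eta> once. The orbits meet in the step after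
  the first time that y(n) lies in the gap (1/2, \<eta> - 1/2), which is where both digits are nonzero.
  So matching is an event about the orbit of 1 alone (\<open>orbits_before_gap\<close>, \<open>finite_matching_index_iff\<close>). For \<eta> = 1 the gap is empty.

  \<^bold>\<open>Intervals.\<close> Once the digits of 1 are prescribed, every y(n) is an affine function of \<eta>, and
  a first visit to the gap at time n is expressed by a finite list of affine inequalities. They can be
  taken strict, because an orbit that touches the boundary of the gap continues at 1 or at
  \<eta> - 1, the mirror image of 1, and never enters the gap. Hence the parameters with a given initial digit
  word form a convex, relatively open set, and these sets are the components of the matching set
  (\<open>components_matching_set\<close>).

  \<^bold>\<open>The invariant measure.\<close> For a matching parameter whose first visit to the gap is at time N,
  the function
  \<open>\<Sum>n\<le>N. (1[z(n), y(n)] + 1[-y(n), -z(n)]) / 2^n\<close> is invariant: transporting the n-th summand yields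
  half of the next one plus half of the first one, and the last summand, where both orbits have nonzero
  digits, yields the first one only (\<open>pair_mass_preimage\<close>). The map is a lift of doubling
  modulo \<eta>. If two invariant densities g1, g2 differed, both sets g1 > g2 and g2 > g1 would be
  forward invariant with positive measure, and by ergodicity of doubling each of them would project
  onto almost the whole circle. But a point between 1 - \<eta> and \<eta> - 1 is alone in its class modulo \<eta>,
  so both sets would contain almost every such point (\<open>acip_unique\<close>).

  \<^bold>\<open>Jumps.\<close> The density jumps at y(n), z(n) and their negatives. All y(n) and -z(n) are positive and
  are right end points of summands, all z(n) and -y(n) are negative and are left end points, so
  jumps at a common point add up and never cancel. A coincidence among the positive break points is an
  orbit that returns or meets its mirror image; such an orbit never enters the gap, unless
  y(N) = \<eta>/2, which happens for at most one \<eta> in a matching interval (\<open>card_breakpoint\<close>).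

  \<^bold>\<open>The exceptional set.\<close> For 1 < \<eta> \<le> 2 and t = 1/\<eta>, matching fails iff the doubling orbit of t on the unit
  circle stays in [1 - t, t] for ever. By ergodicity of doubling such t form a null set. The
  exceptional set has dimension one because it contains 1/t for all t whose binary expansion is a long run of ones, a zero, and then digits
  with much shorter runs. Sequences of blocks \<open>01\<close> followed by q free digits supply such
  tails; reading off the free digits is Hoelder continuous with exponent q / (q + 2), which tends to 1
  as q grows, and maps this part of the exceptional set onto the unit interval
  (\<open>hausdorff_measure_not_matching\<close>).
\<close>

section \<open>The orbits of 1 and of 1 - \<eta>\<close>

definition orbit :: "real \<Rightarrow> nat \<Rightarrow> real" where
  "orbit \<eta> n = (sym_doubling \<eta> ^^ n) 1"

text \<open>
  In the gap the branches of both y = orbit \<eta> n and y - \<eta> have nonzero digits.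
\<close>
definition in_gap :: "real \<Rightarrow> nat \<Rightarrow> bool" where
  "in_gap \<eta> n \<longleftrightarrow> 1 / 2 < orbit \<eta> n \<and> orbit \<eta> n < \<eta> - 1 / 2"

definition first_entry :: "real \<Rightarrow> nat \<Rightarrow> bool" where
  "first_entry \<eta> n \<longleftrightarrow> in_gap \<eta> n \<and> (\<forall>j<n. \<not> in_gap \<eta> j)"

lemma orbit_0 [simp]: "orbit \<eta> 0 = 1"
  by (simp add: orbit_def)

lemma orbit_Suc: "orbit \<eta> (Suc n) = sym_doubling \<eta> (orbit \<eta> n)"
  by (simp add: orbit_def)

lemma orbit_add: "orbit \<eta> (i + k) = (sym_doubling \<eta> ^^ i) (orbit \<eta> k)"
  by (simp add: orbit_def funpow_add)

lemma sym_doubling_uminus: "sym_doubling \<eta> (- x) = - sym_doubling \<eta> x"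
  by (auto simp: sym_doubling_def d1_def)

lemma funpow_sym_doubling_uminus:
  "(sym_doubling \<eta> ^^ n) (- x) = - (sym_doubling \<eta> ^^ n) x"
  by (induction n) (auto simp: sym_doubling_uminus)

lemma sym_doubling_branch:
  shows "x < - 1 / 2 \<Longrightarrow> sym_doubling \<eta> x = 2 * x + \<eta>"
    and "- 1 / 2 \<le> x \<Longrightarrow> x \<le> 1 / 2 \<Longrightarrow> sym_doubling \<eta> x = 2 * x"
    and "1 / 2 < x \<Longrightarrow> sym_doubling \<eta> x = 2 * x - \<eta>"
  by (auto simp: sym_doubling_def d1_def)

lemma first_entry_exists:
  assumes "in_gap \<eta> n"
  obtains m where "first_entry \<eta> m"
  using assms exists_least_iff[of "in_gap \<eta>"] unfolding first_entry_def by blast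

text \<open>
  Outside the gap, either y \<le> 1/2 and then y - \<eta> < -1/2 lies on the left branch, or y \<ge> \<eta> - 1/2 and
  then y - \<eta> lies on the middle branch while y lies on the right one. In both cases exactly one of the
  two digits contributes, so the distance \<eta> is reproduced. The bounds keep y in [\<eta> - 1, 1], which
  excludes all other combinations of branches.
\<close>
lemma orbits_before_gap:
  assumes "1 < \<eta>" "\<eta> \<le> 2" and "\<forall>j<n. \<not> in_gap \<eta> j"
  shows "(sym_doubling \<eta> ^^ n) (1 - \<eta>) = orbit \<eta> n - \<eta> \<and>
         \<eta> - 1 \<le> orbit \<eta> n \<and> orbit \<eta> n \<le> 1"
  using assms(3)
proof (induction n)
  case 0
  then show ?case using assms by simp
next
  case (Suc n)
  let ?y = "orbit \<eta> n"
  have IH: "(sym_doubling \<eta> ^^ n) (1 - \<eta>) = ?y - \<eta>" "\<eta> - 1 \<le> ?y" "?y \<le> 1"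
    using Suc by auto
  have "\<not> in_gap \<eta> n"
    using Suc.prems by simp
  then consider "?y \<le> 1 / 2" | "?y \<ge> \<eta> - 1 / 2"
    unfolding in_gap_def by linarith
  then have "sym_doubling \<eta> (?y - \<eta>) = sym_doubling \<eta> ?y - \<eta> \<and>
      \<eta> - 1 \<le> sym_doubling \<eta> ?y \<and> sym_doubling \<eta> ?y \<le> 1"
    using assms(1,2) IH by cases (auto simp: sym_doubling_branch)
  then show ?case
    by (simp add: orbit_Suc IH(1))
qed

lemma orbits_merge_after_gap:
  assumes "1 < \<eta>" "\<eta> \<le> 2" and "first_entry \<eta> n"
  shows "(sym_doubling \<eta> ^^ Suc n) (1 - \<eta>) = orbit \<eta> (Suc n)"
proof -
  have "(sym_doubling \<eta> ^^ n) (1 - \<eta>) = orbit \<eta> n - \<eta>"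
    using assms orbits_before_gap unfolding first_entry_def by blast
  moreover have "sym_doubling \<eta> (orbit \<eta> n - \<eta>) = sym_doubling \<eta> (orbit \<eta> n)"
    using assms by (simp add: first_entry_def in_gap_def sym_doubling_branch)
  ultimately show ?thesis
    by (simp add: orbit_Suc)
qed

lemma matching_index_first_entry:
  assumes "1 < \<eta>" "\<eta> \<le> 2" and "first_entry \<eta> n"
  shows "matching_index \<eta> = enat (Suc n)"
  unfolding matching_index_def
proof (rule antisym)
  show "Inf {enat m | m. 1 \<le> m \<and> (sym_doubling \<eta> ^^ m) 1 = (sym_doubling \<eta> ^^ m) (1 - \<eta>)}
        \<le> enat (Suc n)"
    using orbits_merge_after_gap[OF assms] unfolding orbit_def
    by (intro Inf_lower) (auto intro!: exI[of _ "Suc n"])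
  have "Suc n \<le> m" if "(sym_doubling \<eta> ^^ m) 1 = (sym_doubling \<eta> ^^ m) (1 - \<eta>)" for m
  proof (rule ccontr)
    assume "\<not> Suc n \<le> m"
    then have "(sym_doubling \<eta> ^^ m) (1 - \<eta>) = orbit \<eta> m - \<eta>"
      using assms orbits_before_gap[of \<eta> m] unfolding first_entry_def by auto
    then show False
      using that assms(1) unfolding orbit_def by simp
  qed
  then show "enat (Suc n)
    \<le> Inf {enat m | m. 1 \<le> m \<and> (sym_doubling \<eta> ^^ m) 1 = (sym_doubling \<eta> ^^ m) (1 - \<eta>)}"
    by (intro Inf_greatest) auto
qed

lemma matching_index_1: "matching_index 1 = \<infinity>"
proof -
  have "(sym_doubling 1 ^^ n) 1 = 1" "(sym_doubling 1 ^^ n) 0 = 0" for n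
    by (induction n) (auto simp: sym_doubling_def d1_def)
  then show ?thesis
    unfolding matching_index_def by (simp add: top_enat_def)
qed

lemma finite_matching_index_iff:
  assumes "1 \<le> \<eta>" "\<eta> \<le> 2"
  shows "matching_index \<eta> < \<infinity> \<longleftrightarrow> (\<exists>n. first_entry \<eta> n)"
proof (cases "\<eta> = 1")
  case True
  then show ?thesis
    by (auto simp: matching_index_1 first_entry_def in_gap_def)
next
  case False
  then have \<eta>: "1 < \<eta>" using assms by simp
  show ?thesis
  proof
    assume "\<exists>n. first_entry \<eta> n"
    then show "matching_index \<eta> < \<infinity>"
      using matching_index_first_entry[OF \<eta> assms(2)] by auto
  next
    assume fin: "matching_index \<eta> < \<infinity>"
    show "\<exists>n. first_entry \<eta> n"
    proof (rule ccontr)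
      assume "\<nexists>n. first_entry \<eta> n"
      then have "\<not> in_gap \<eta> n" for n
        using first_entry_exists by blast
      then have "(sym_doubling \<eta> ^^ n) 1 \<noteq> (sym_doubling \<eta> ^^ n) (1 - \<eta>)" for n
        using orbits_before_gap[OF \<eta> assms(2), of n] \<eta> unfolding orbit_def by auto
      then show False
        using fin unfolding matching_index_def by (simp add: top_enat_def)
    qed
  qed
qed

lemma initial_digits_first_entry:
  assumes "1 < \<eta>" "\<eta> \<le> 2" and "first_entry \<eta> n"
  shows "initial_digits \<eta> = map (\<lambda>j. d1 (orbit \<eta> j)) [0..<Suc n]"
proof -
  have "initial_digits \<eta> = map (\<lambda>j. digit \<eta> j 1) (map Suc [0..<Suc n])"
    unfolding initial_digits_def
    by (simp only: matching_index_first_entry[OF assms] the_enat.simps map_Suc_upt One_nat_def)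
  then show ?thesis
    by (simp add: digit_def orbit_def)
qed

text \<open>
  A repetition would make the orbit periodic from then on, so the visit to the gap at time n would
  already have occurred earlier.
\<close>
lemma orbit_no_return_before_entry:
  assumes "first_entry \<eta> n" and "i < j" "j \<le> n"
  shows "orbit \<eta> i \<noteq> orbit \<eta> j"
proof
  assume "orbit \<eta> i = orbit \<eta> j"
  then have "orbit \<eta> ((n - j) + i) = orbit \<eta> ((n - j) + j)"
    by (simp only: orbit_add)
  then have "in_gap \<eta> ((n - j) + i)"
    using assms by (simp add: first_entry_def in_gap_def)
  moreover have "(n - j) + i < n"
    using assms(2,3) by linarith
  ultimately show False
    using assms(1) by (auto simp: first_entry_def)
qed

text \<open>
  By oddness of the map, an orbit of 1 that meets the negative of the orbit of 1 - \<eta> follows it from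
  then on. The gap is symmetric under the mirror map y to \<eta> - y, so again the visit to the gap would
  have occurred earlier.
\<close>
lemma orbit_no_mirror_before_entry:
  assumes \<eta>: "1 < \<eta>" "\<eta> \<le> 2" and "first_entry \<eta> n" and "i < j" "j \<le> n"
  shows "orbit \<eta> j \<noteq> \<eta> - orbit \<eta> i"
proof
  assume eq: "orbit \<eta> j = \<eta> - orbit \<eta> i"
  let ?i = "(n - j) + i"
  have lt: "?i < n"
    using assms(4,5) by linarith
  have Z: "(sym_doubling \<eta> ^^ k) (1 - \<eta>) = orbit \<eta> k - \<eta>" if "k \<le> n" for k
    using orbits_before_gap[OF \<eta>, of k] assms(3) that by (auto simp: first_entry_def)
  have "orbit \<eta> j = - (sym_doubling \<eta> ^^ i) (1 - \<eta>)"
    using Z[of i] assms(4,5) eq by simp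
  then have "orbit \<eta> ((n - j) + j) = - (sym_doubling \<eta> ^^ ?i) (1 - \<eta>)"
    by (simp only: orbit_add funpow_sym_doubling_uminus funpow_add o_apply)
  then have "orbit \<eta> n = \<eta> - orbit \<eta> ?i"
    using Z[of ?i] lt assms(5) by simp
  then have "in_gap \<eta> ?i"
    using assms(3) by (auto simp: first_entry_def in_gap_def)
  then show False
    using assms(3) lt by (auto simp: first_entry_def)
qed

text \<open>
  The point 1/2 is mapped to 1, the starting point, and \<eta> - 1/2 is mapped to \<eta> - 1, its mirror
  image. This strictness is what makes matching an open condition on \<eta>.
\<close>
lemma orbit_avoids_gap_boundary:
  assumes \<eta>: "1 < \<eta>" "\<eta> \<le> 2" and fe: "first_entry \<eta> n" and "j < n"
  shows "orbit \<eta> j < 1 / 2 \<or> orbit \<eta> j > \<eta> - 1 / 2"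
proof -
  have "orbit \<eta> j \<noteq> 1 / 2"
  proof
    assume "orbit \<eta> j = 1 / 2"
    then have "orbit \<eta> (Suc j) = orbit \<eta> 0"
      by (simp add: orbit_Suc sym_doubling_def d1_def)
    then show False
      using orbit_no_return_before_entry[OF fe, of 0 "Suc j"] \<open>j < n\<close> by simp
  qed
  moreover have "orbit \<eta> j \<noteq> \<eta> - 1 / 2"
  proof
    assume "orbit \<eta> j = \<eta> - 1 / 2"
    then have "orbit \<eta> (Suc j) = \<eta> - orbit \<eta> 0"
      using \<eta> by (simp add: orbit_Suc sym_doubling_def d1_def)
    then show False
      using orbit_no_mirror_before_entry[OF \<eta> fe, of 0 "Suc j"] \<open>j < n\<close> by simp
  qed
  moreover have "\<not> in_gap \<eta> j"
    using fe \<open>j < n\<close> by (simp add: first_entry_def)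
  ultimately show ?thesis
    unfolding in_gap_def by linarith
qed

section \<open>Matching intervals are cylinders\<close>

text \<open>
  The n-th image of 1 along a prescribed digit sequence. For a fixed sequence it is affine in the
  parameter, whereas the true orbit is only piecewise affine.
\<close>
fun digit_orbit :: "(nat \<Rightarrow> int) \<Rightarrow> nat \<Rightarrow> real \<Rightarrow> real" where
  "digit_orbit e 0 \<eta> = 1"
| "digit_orbit e (Suc n) \<eta> = 2 * digit_orbit e n \<eta> - of_int (e n) * \<eta>"

lemma digit_orbit_affine: "\<exists>c. \<forall>\<eta>. digit_orbit e n \<eta> = 2 ^ n - c * \<eta>"
proof (induction n)
  case 0
  show ?case by (auto intro: exI[of _ 0])
next
  case (Suc n)
  then obtain c where "\<forall>\<eta>. digit_orbit e n \<eta> = 2 ^ n - c * \<eta>" by blast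
  then show ?case
    by (intro exI[of _ "2 * c + of_int (e n)"]) (auto simp: left_diff_distrib distrib_right)
qed

lemma continuous_on_digit_orbit [continuous_intros]:
  "continuous_on A (digit_orbit e n)"
  by (induction n) (auto intro!: continuous_intros)

lemma orbit_eq_digit_orbit:
  assumes "\<forall>j<n. d1 (orbit \<eta> j) = e j"
  shows "orbit \<eta> n = digit_orbit e n \<eta>"
  using assms by (induction n) (auto simp: orbit_Suc sym_doubling_def)

text \<open>
  The affine inequalities which say that the orbit of 1 follows the digits e and first enters the gap
  at time n. Digits in {0, 1} are the only relevant ones, as the orbit stays positive up to then.
\<close>
definition param_cylinder :: "(nat \<Rightarrow> int) \<Rightarrow> nat \<Rightarrow> real set" where
  "param_cylinder e n = {\<eta> \<in> {1<..2}.
     (\<forall>j<n. if e j = 0 then digit_orbit e j \<eta> < 1 / 2 else digit_orbit e j \<eta> > \<eta> - 1 / 2) \<and>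
     1 / 2 < digit_orbit e n \<eta> \<and> digit_orbit e n \<eta> < \<eta> - 1 / 2}"

lemma convex_param_cylinder: "convex (param_cylinder e n)"
proof -
  have half: "convex {\<eta>. digit_orbit e j \<eta> < a * \<eta> + b}" "convex {\<eta>. digit_orbit e j \<eta> > a * \<eta> + b}"
    for j a b
  proof -
    obtain c where c: "\<forall>\<eta>. digit_orbit e j \<eta> = 2 ^ j - c * \<eta>"
      using digit_orbit_affine by blast
    have "{\<eta>. digit_orbit e j \<eta> < a * \<eta> + b} = {\<eta>. inner (- c - a) \<eta> < b - 2 ^ j}"
      "{\<eta>. digit_orbit e j \<eta> > a * \<eta> + b} = {\<eta>. inner (- c - a) \<eta> > b - 2 ^ j}"
      unfolding c[rule_format] by (auto simp: algebra_simps)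
    then show "convex {\<eta>. digit_orbit e j \<eta> < a * \<eta> + b}" "convex {\<eta>. digit_orbit e j \<eta> > a * \<eta> + b}"
      using convex_halfspace_lt convex_halfspace_gt by metis+
  qed
  have lt: "convex {\<eta>. digit_orbit e j \<eta> < 1 / 2}" "convex {\<eta>. digit_orbit e j \<eta> < \<eta> - 1 / 2}" for j
    using half(1)[of j 0 "1 / 2"] half(1)[of j 1 "- 1 / 2"] by simp_all
  have gt: "convex {\<eta>. digit_orbit e j \<eta> > 1 / 2}" "convex {\<eta>. digit_orbit e j \<eta> > \<eta> - 1 / 2}" for j
    using half(2)[of 0 "1 / 2" j] half(2)[of 1 "- 1 / 2" j] by simp_all
  have "param_cylinder e n = {1<..2} \<inter>
     (\<Inter>j\<in>{..<n}. if e j = 0 then {\<eta>. digit_orbit e j \<eta> < 1 / 2}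
                  else {\<eta>. digit_orbit e j \<eta> > \<eta> - 1 / 2}) \<inter>
     {\<eta>. digit_orbit e n \<eta> > 1 / 2} \<inter> {\<eta>. digit_orbit e n \<eta> < \<eta> - 1 / 2}"
    unfolding param_cylinder_def by (auto split: if_splits)
  moreover have "convex (if e j = 0 then {\<eta>. digit_orbit e j \<eta> < 1 / 2}
                  else {\<eta>. digit_orbit e j \<eta> > \<eta> - 1 / 2})" for j
    using lt gt by presburger
  ultimately show ?thesis
    using lt gt by (simp only: convex_Int convex_INT convex_real_interval)
qed

lemma param_cylinder_open:
  obtains U where "open U" "param_cylinder e n = U \<inter> {1..2}"
proof
  let ?U = "{1<..} \<inter>
     (\<Inter>j\<in>{..<n}. if e j = 0 then {\<eta>. digit_orbit e j \<eta> < 1 / 2}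
                  else {\<eta>. digit_orbit e j \<eta> > \<eta> - 1 / 2}) \<inter>
     ({\<eta>. digit_orbit e n \<eta> > 1 / 2} \<inter> {\<eta>. digit_orbit e n \<eta> < \<eta> - 1 / 2})"
  have "open {\<eta>. digit_orbit e j \<eta> < 1 / 2}" "open {\<eta>. digit_orbit e j \<eta> > 1 / 2}"
    "open {\<eta>. digit_orbit e j \<eta> > \<eta> - 1 / 2}" "open {\<eta>. digit_orbit e j \<eta> < \<eta> - 1 / 2}" for j
    by (intro open_Collect_less continuous_intros)+
  then show "open ?U"
    by (intro open_Int open_INT) auto
  show "param_cylinder e n = ?U \<inter> {1..2}"
    unfolding param_cylinder_def by (auto split: if_splits)
qed

lemma param_cylinderD:
  assumes "\<eta> \<in> param_cylinder e n" and e: "\<forall>j<n. e j \<in> {0, 1}" "e n = 1"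
  shows "first_entry \<eta> n" and "\<forall>j\<le>n. d1 (orbit \<eta> j) = e j"
proof -
  have \<eta>: "1 < \<eta>" "\<eta> \<le> 2"
    and low: "\<And>j. j < n \<Longrightarrow> e j = 0 \<Longrightarrow> digit_orbit e j \<eta> < 1 / 2"
    and high: "\<And>j. j < n \<Longrightarrow> e j \<noteq> 0 \<Longrightarrow> digit_orbit e j \<eta> > \<eta> - 1 / 2"
    and last: "1 / 2 < digit_orbit e n \<eta>" "digit_orbit e n \<eta> < \<eta> - 1 / 2"
    using assms(1) by (auto simp: param_cylinder_def)
  have *: "(\<forall>i<j. d1 (orbit \<eta> i) = e i) \<and> (\<forall>i<j. \<not> in_gap \<eta> i)" if "j \<le> n" for j
    using that
  proof (induction j)
    case (Suc j)
    have IH: "\<forall>i<j. d1 (orbit \<eta> i) = e i" "\<forall>i<j. \<not> in_gap \<eta> i"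
      using Suc by auto
    have "orbit \<eta> j = digit_orbit e j \<eta>" "orbit \<eta> j \<ge> \<eta> - 1"
      using orbit_eq_digit_orbit[OF IH(1)] orbits_before_gap[OF \<eta> IH(2)] by auto
    moreover have "e j = 0 \<or> e j = 1" using e Suc.prems by auto
    ultimately have "d1 (orbit \<eta> j) = e j" "\<not> in_gap \<eta> j"
      using low[of j] high[of j] Suc.prems \<eta> by (auto simp: d1_def in_gap_def)
    then show ?case using IH by (auto simp: less_Suc_eq)
  qed simp
  have "orbit \<eta> n = digit_orbit e n \<eta>"
    using *[of n] orbit_eq_digit_orbit by auto
  then show "first_entry \<eta> n"
    using *[of n] last by (auto simp: first_entry_def in_gap_def)
  have "d1 (orbit \<eta> n) = e n"
    using \<open>orbit \<eta> n = digit_orbit e n \<eta>\<close> last e by (auto simp: d1_def)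
  then show "\<forall>j\<le>n. d1 (orbit \<eta> j) = e j"
    using *[of n] by (auto simp: le_less)
qed

lemma digits_before_entry:
  assumes \<eta>: "1 < \<eta>" "\<eta> \<le> 2" and fe: "first_entry \<eta> n"
  shows "\<forall>j<n. d1 (orbit \<eta> j) \<in> {0, 1}" and "d1 (orbit \<eta> n) = 1"
proof -
  have "0 < orbit \<eta> j" if "j < n" for j
    using orbits_before_gap[OF \<eta>, of j] fe that \<eta> by (auto simp: first_entry_def)
  then show "\<forall>j<n. d1 (orbit \<eta> j) \<in> {0, 1}"
    by (force simp: d1_def)
  show "d1 (orbit \<eta> n) = 1"
    using fe by (auto simp: d1_def first_entry_def in_gap_def)
qed

lemma in_param_cylinder:
  assumes \<eta>: "1 < \<eta>" "\<eta> \<le> 2" and fe: "first_entry \<eta> n"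
    and e: "\<forall>j\<le>n. d1 (orbit \<eta> j) = e j"
  shows "\<eta> \<in> param_cylinder e n"
proof -
  have Y: "orbit \<eta> j = digit_orbit e j \<eta>" if "j \<le> n" for j
    using orbit_eq_digit_orbit[of j \<eta> e] e that by auto
  have "\<forall>j<n. if e j = 0 then digit_orbit e j \<eta> < 1 / 2 else digit_orbit e j \<eta> > \<eta> - 1 / 2"
  proof (intro allI impI)
    fix j assume that: "j < n"
    have "d1 (orbit \<eta> j) = e j" using e that by simp
    then show "if e j = 0 then digit_orbit e j \<eta> < 1 / 2 else digit_orbit e j \<eta> > \<eta> - 1 / 2"
      using orbit_avoids_gap_boundary[OF \<eta> fe that] Y[of j] \<eta> that
        orbits_before_gap[OF \<eta>, of j] fe
      by (auto simp: d1_def first_entry_def split: if_splits)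
  qed
  moreover have "1 / 2 < digit_orbit e n \<eta>" "digit_orbit e n \<eta> < \<eta> - 1 / 2"
    using fe Y[of n] by (simp_all add: first_entry_def in_gap_def)
  ultimately show ?thesis
    unfolding param_cylinder_def using \<eta> by simp
qed

definition matching_set :: "real set" where
  "matching_set = {\<eta> \<in> {1..2}. matching_index \<eta> < \<infinity>}"

lemma matching_set_iff: "\<eta> \<in> matching_set \<longleftrightarrow> 1 < \<eta> \<and> \<eta> \<le> 2 \<and> (\<exists>n. first_entry \<eta> n)"
  using finite_matching_index_iff[of \<eta>] matching_index_1
  by (cases "\<eta> = 1") (auto simp: matching_set_def)

text \<open>
  The word of initial digits has length n + 1, so it records the time of the first entry as well.
\<close>
lemma same_initial_digits_eq_cylinder:
  assumes \<eta>: "1 < \<eta>" "\<eta> \<le> 2" and fe: "first_entry \<eta> n"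
  shows "{\<eta>' \<in> matching_set. initial_digits \<eta>' = initial_digits \<eta>}
           = param_cylinder (\<lambda>j. d1 (orbit \<eta> j)) n"
proof (intro equalityI subsetI)
  fix \<eta>' assume "\<eta>' \<in> {\<eta>' \<in> matching_set. initial_digits \<eta>' = initial_digits \<eta>}"
  then obtain m where m: "1 < \<eta>'" "\<eta>' \<le> 2" "first_entry \<eta>' m"
    and eq: "initial_digits \<eta>' = initial_digits \<eta>"
    by (auto simp: matching_set_iff)
  have "map (\<lambda>j. d1 (orbit \<eta>' j)) [0..<Suc m] = map (\<lambda>j. d1 (orbit \<eta> j)) [0..<Suc n]"
    using eq initial_digits_first_entry m \<eta> fe by simp
  moreover from arg_cong[OF this, of length] have "m = n" by simp
  ultimately have "\<forall>j<Suc n. d1 (orbit \<eta>' j) = d1 (orbit \<eta> j)"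
    by (simp del: upt_Suc)
  then show "\<eta>' \<in> param_cylinder (\<lambda>j. d1 (orbit \<eta> j)) n"
    using m \<open>m = n\<close> in_param_cylinder[of \<eta>' n] by (auto simp: less_Suc_eq_le)
next
  fix \<eta>' assume \<eta>': "\<eta>' \<in> param_cylinder (\<lambda>j. d1 (orbit \<eta> j)) n"
  then have fe': "first_entry \<eta>' n" and d: "\<forall>j\<le>n. d1 (orbit \<eta>' j) = d1 (orbit \<eta> j)"
    using param_cylinderD[OF \<eta>'] digits_before_entry[OF assms] by auto
  have "1 < \<eta>'" "\<eta>' \<le> 2" using \<eta>' by (auto simp: param_cylinder_def)
  then show "\<eta>' \<in> {\<eta>' \<in> matching_set. initial_digits \<eta>' = initial_digits \<eta>}"
    using fe' d \<eta> fe by (auto simp: matching_set_iff initial_digits_first_entry)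
qed

text \<open>
  Each cylinder is convex, so it lies in one component. Each cylinder is also relatively open, so the
  digit word is locally constant on the matching set and hence constant on a component.
\<close>
lemma components_matching_set:
  assumes "J \<in> components matching_set" and "\<eta> \<in> J"
  shows "J = {\<eta>' \<in> matching_set. initial_digits \<eta>' = initial_digits \<eta>}"
proof -
  define C where "C \<zeta> = {\<eta>' \<in> matching_set. initial_digits \<eta>' = initial_digits \<zeta>}" for \<zeta>
  have J: "J \<subseteq> matching_set" "connected J"
    using in_components_subset[OF assms(1)] in_components_connected[OF assms(1)] by auto
  have C: "\<exists>e n. C \<zeta> = param_cylinder e n" if \<zeta>: "\<zeta> \<in> matching_set" for \<zeta>
  proof -
    obtain n where "1 < \<zeta>" "\<zeta> \<le> 2" "first_entry \<zeta> n"
      using \<zeta> by (auto simp: matching_set_iff)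
    then show ?thesis
      using same_initial_digits_eq_cylinder unfolding C_def by blast
  qed
  have "connected (C \<eta>)"
    using C[of \<eta>] assms(2) J(1) convex_connected[OF convex_param_cylinder] by force
  moreover have "\<eta> \<in> C \<eta>" "C \<eta> \<subseteq> matching_set"
    using assms(2) J(1) by (auto simp: C_def)
  ultimately have "C \<eta> \<subseteq> J"
    using components_maximal[OF assms(1)] assms(2) by blast
  moreover have "initial_digits \<zeta> = initial_digits \<eta>" if "\<zeta> \<in> J" for \<zeta>
    using \<open>connected J\<close> that assms(2)
  proof (rule connected_local_const, intro ballI)
    fix a assume a: "a \<in> J"
    then obtain e n where "C a = param_cylinder e n"
      using C J(1) by blast
    then obtain U where U: "open U" "C a = U \<inter> {1..2}"
      using param_cylinder_open by metis
    have "a \<in> U"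
      using U a J(1) by (auto simp: C_def)
    then have "eventually (\<lambda>b. b \<in> U \<and> b \<in> J) (at a within J)"
      using U(1) by (auto simp: eventually_at_topological)
    then show "eventually (\<lambda>b. initial_digits a = initial_digits b) (at a within J)"
    proof eventually_elim
      case (elim b)
      then have "b \<in> C a" using U J(1) by (auto simp: matching_set_iff)
      then show ?case by (simp add: C_def)
    qed
  qed
  ultimately show ?thesis
    using J(1) unfolding C_def by blast
qed

lemma matching_set_open:
  obtains U where "open U" "matching_set = U \<inter> {1..2}"
proof -
  have "\<exists>U. open U \<and> \<eta> \<in> U \<and> U \<inter> {1..2} \<subseteq> matching_set" if \<eta>: "\<eta> \<in> matching_set" for \<eta>
  proof -
    obtain n where n: "1 < \<eta>" "\<eta> \<le> 2" "first_entry \<eta> n"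
      using \<eta> by (auto simp: matching_set_iff)
    obtain U where "open U" "param_cylinder (\<lambda>j. d1 (orbit \<eta> j)) n = U \<inter> {1..2}"
      using param_cylinder_open .
    then show ?thesis
      using same_initial_digits_eq_cylinder[OF n] \<eta> by blast
  qed
  then obtain U where U: "\<And>\<eta>. \<eta> \<in> matching_set \<Longrightarrow> open (U \<eta>) \<and> \<eta> \<in> U \<eta> \<and> U \<eta> \<inter> {1..2} \<subseteq> matching_set"
    by metis
  show ?thesis
  proof
    show "open (\<Union>\<eta>\<in>matching_set. U \<eta>)" using U by blast
    show "matching_set = (\<Union>\<eta>\<in>matching_set. U \<eta>) \<inter> {1..2}"
    proof
      show "matching_set \<subseteq> (\<Union>\<eta>\<in>matching_set. U \<eta>) \<inter> {1..2}"
        using U by (force simp: matching_set_def)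
    qed (use U in blast)
  qed
qed

lemma interior_matching_interval:
  assumes "J \<in> components matching_set"
  shows "interior J \<noteq> {}"
proof -
  obtain \<eta> where \<eta>: "\<eta> \<in> J" "\<eta> \<in> matching_set"
    using assms in_components_nonempty in_components_subset by blast
  then obtain n where n: "1 < \<eta>" "\<eta> \<le> 2" "first_entry \<eta> n"
    by (auto simp: matching_set_iff)
  obtain U where U: "open U" "param_cylinder (\<lambda>j. d1 (orbit \<eta> j)) n = U \<inter> {1..2}"
    using param_cylinder_open .
  have J: "J = U \<inter> {1..2}"
    using components_matching_set[OF assms \<eta>(1)] same_initial_digits_eq_cylinder[OF n] U(2) by simp
  have "\<eta> \<in> closure {1<..<2::real}"
    using n by simp
  then have "U \<inter> {1<..<2} \<noteq> {}"
    using U(1) \<eta>(1) J open_Int_closure_eq_empty[of U "{1<..<2}"] by blast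
  moreover have "U \<inter> {1<..<2} \<subseteq> interior J"
    using U(1) J by (intro interior_maximal) auto
  ultimately show ?thesis by blast
qed

lemma Union_matching_intervals: "\<Union> matching_intervals = matching_set"
  unfolding matching_intervals_def matching_set_def[symmetric] by simp

section \<open>Ergodicity of doubling\<close>

lemma lborel_measure_translate:
  assumes "A \<in> sets borel"
  shows "measure lborel {x. x + c \<in> A} = measure lborel (A :: real set)"
proof -
  have "emeasure lborel A = emeasure (distr lborel borel ((+) c)) A"
    by (simp add: lborel_distr_plus)
  also have "\<dots> = emeasure lborel {x. x + c \<in> A}"
    using assms by (subst emeasure_distr) (auto simp: vimage_def add.commute)
  finally show ?thesis by (simp add: measure_def)
qed

lemma lborel_measure_scale:
  assumes "A \<in> sets borel" "c > 0"
  shows "measure lborel {x. c * x \<in> A} = measure lborel (A :: real set) / c"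
proof -
  have "emeasure lborel {x. c * x \<in> A} = emeasure (distr lborel borel ((*) c)) A"
    using assms by (subst emeasure_distr) (auto simp: vimage_def)
  also have "\<dots> = ennreal (inverse c) * emeasure lborel A"
    using assms by (simp add: lborel_distr_mult emeasure_density nn_integral_cmult_indicator)
  finally show ?thesis
    using assms by (simp add: measure_def enn2real_mult field_simps)
qed

text \<open>
  Ergodicity of doubling on the circle of length T, for sets that are only forward invariant. Let F be
  the distribution function of Q, and D its deviation from the linear function with the same value at
  T. Forward invariance and preservation of length give F t = F (2 t) / 2, so D t = D (2 t) / 2; as D is
  T-periodic and bounded, iterating this forces D = 0. So Q has constant density q in every
  interval, and if q is not 0, then Lebesgue measure restricted to Q and divided by q is Lebesgue measure,
  which leaves no mass for the complement of Q.
\<close>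
lemma periodic_doubling_zero_one:
  fixes Q :: "real set"
  assumes Q [measurable]: "Q \<in> sets borel" and T: "T > 0"
    and per: "\<And>x. x + T \<in> Q \<longleftrightarrow> x \<in> Q"
    and dbl: "AE x in lborel. x \<in> Q \<longrightarrow> 2 * x \<in> Q"
  shows "(AE x in lborel. x \<notin> Q) \<or> (AE x in lborel. x \<in> Q)"
proof -
  define F where "F a b = measure lborel (Q \<inter> {a..<b})" for a b
  have fin: "emeasure lborel (A \<inter> {a..<b}) < \<infinity>" for a b :: real and A
    by (rule le_less_trans[OF emeasure_mono[of _ "{a..<b}"]]) (cases "a \<le> b"; simp)+
  have fm: "A \<inter> {a..<b} \<in> fmeasurable lborel" if "A \<in> sets borel" for A and a b :: real
    using fin[of A a b] that by (intro fmeasurableI) auto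
  have F_add: "F a c = F a b + F b c" if "a \<le> b" "b \<le> c" for a b c
  proof -
    have "Q \<inter> {a..<c} = (Q \<inter> {a..<b}) \<union> (Q \<inter> {b..<c})" using that by auto
    then show ?thesis unfolding F_def
      using fin[of Q a b] fin[of Q b c] by (subst measure_Union[symmetric]) auto
  qed
  have F_shift: "F (a + T) (b + T) = F a b" for a b
  proof -
    have "{x. x + T \<in> Q \<inter> {a + T..<b + T}} = Q \<inter> {a..<b}" using per by auto
    then show ?thesis
      unfolding F_def using lborel_measure_translate[of "Q \<inter> {a + T..<b + T}" T] by simp
  qed
  \<comment> \<open>Q is contained in its preimage under doubling up to a null set, and the preimage of an interval has half its length.\<close>
  have F_double: "F a b \<le> F (2 * a) (2 * b) / 2" for a b
  proof -
    have "F a b \<le> measure lborel {x. 2 * x \<in> Q \<inter> {2 * a..<2 * b}}"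
      unfolding F_def measure_def
    proof (rule enn2real_mono[OF emeasure_mono_AE])
      show "AE x in lborel. x \<in> Q \<inter> {a..<b} \<longrightarrow> x \<in> {x. 2 * x \<in> Q \<inter> {2 * a..<2 * b}}"
        using dbl by eventually_elim auto
      have "{x. 2 * x \<in> Q \<inter> {2 * a..<2 * b}} = {x. 2 * x \<in> Q} \<inter> {a..<b}" by auto
      moreover have "{x. 2 * x \<in> Q} \<in> sets borel" by measurable
      ultimately show "{x. 2 * x \<in> Q \<inter> {2 * a..<2 * b}} \<in> sets lborel"
        "emeasure lborel {x. 2 * x \<in> Q \<inter> {2 * a..<2 * b}} < top"
        using fin[of "{x. 2 * x \<in> Q}" a b] by simp_all
    qed
    also have "\<dots> = F (2 * a) (2 * b) / 2"
      unfolding F_def by (rule lborel_measure_scale) auto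
    finally show ?thesis .
  qed
  define q where "q = F 0 T / T"
  define D where "D t = F 0 t - q * t" for t
  have F_0_shift: "F 0 (t + T) = F 0 t + F 0 T" if "t \<ge> 0" for t
    using F_add[of 0 T "t + T"] F_shift[of 0 t] that T by simp
  have D_shift: "D (t + T) = D t" if "t \<ge> 0" for t
    using F_0_shift[OF that] T by (simp add: D_def q_def field_simps)
  have D_double: "D t = D (2 * t) / 2" if "0 \<le> t" "t \<le> T" for t
  proof -
    \<comment> \<open>The inequalities on [0, t] and [t, T] add up to an equality on [0, T], so both are equalities.\<close>
    have "F 0 T = F 0 t + F t T" "F 0 (2 * T) = F 0 (2 * t) + F (2 * t) (2 * T)" "F 0 (2 * T) = 2 * F 0 T"
      using F_add[of 0 t T] F_add[of 0 "2 * t" "2 * T"] that T F_0_shift[of T] by simp_all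
    then have "F 0 t = F 0 (2 * t) / 2"
      using F_double[of 0 t] F_double[of t T] by simp
    then show ?thesis by (simp add: D_def)
  qed
  have F_le: "0 \<le> F a b" "a \<le> b \<Longrightarrow> F a b \<le> b - a" for a b
    using measure_mono_fmeasurable[of "Q \<inter> {a..<b}" "{a..<b}" lborel] fm[of UNIV a b]
    by (auto simp: F_def)
  \<comment> \<open>Two periods, so that both t and 2 t stay in the range of the induction.\<close>
  have bound: "\<forall>t\<in>{0..2 * T}. \<bar>D t\<bar> \<le> 2 * T / 2 ^ n" for n
  proof (induction n)
    case 0
    have "0 \<le> q" "q \<le> 1"
      using F_le[of 0 T] T by (auto simp: q_def)
    then have qt: "0 \<le> q * t" "q * t \<le> t" if "0 \<le> t" for t
      using that by (auto simp: mult_left_le_one_le)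
    show ?case
    proof
      fix t assume "t \<in> {0..2 * T}"
      then show "\<bar>D t\<bar> \<le> 2 * T / 2 ^ 0"
        using F_le[of 0 t] qt[of t] by (simp add: D_def)
    qed
  next
    case (Suc n)
    have low: "\<bar>D t\<bar> \<le> 2 * T / 2 ^ Suc n" if "0 \<le> t" "t \<le> T" for t
      using Suc[rule_format, of "2 * t"] D_double[OF that] that by simp
    have "\<bar>D t\<bar> \<le> 2 * T / 2 ^ Suc n" if "T < t" "t \<le> 2 * T" for t
      using low[of "t - T"] D_shift[of "t - T"] that by simp
    then show ?case using low by fastforce
  qed
  have D_0: "D t = 0" if "0 \<le> t" "t \<le> T" for t
  proof -
    have "(\<lambda>n. 2 * T / 2 ^ n) \<longlonglongrightarrow> 0"
      by (rule LIMSEQ_divide_realpow_zero) simp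
    moreover have "eventually (\<lambda>n. \<bar>D t\<bar> \<le> 2 * T / 2 ^ n) sequentially"
      using bound that by (intro always_eventually) auto
    ultimately have "\<bar>D t\<bar> \<le> 0"
      by (intro tendsto_lowerbound) auto
    then show ?thesis by simp
  qed
  have D_0': "D t = 0" if "0 \<le> t" "t \<le> of_nat k * T" for t k
    using that
  proof (induction k arbitrary: t)
    case 0
    then show ?case using D_0[of t] T by simp
  next
    case (Suc k)
    then show ?case
      using D_0[of t] D_shift[of "t - T"] Suc.IH[of "t - T"] by (cases "t \<le> T") (auto simp: field_simps)
  qed
  have F_eq: "F a b = q * (b - a)" if "0 \<le> a" "a \<le> b" for a b
  proof -
    obtain k where "b \<le> of_nat k * T"
      using reals_Archimedean3[OF T] less_imp_le by blast
    then have "D a = 0" "D b = 0" using D_0'[of _ k] that by auto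
    then show ?thesis using F_add[of 0 a b] that by (simp add: D_def algebra_simps)
  qed
  have F_eq': "F a b = q * (b - a)" if "- (of_nat k * T) \<le> a" "a \<le> b" for a b k
    using that
  proof (induction k arbitrary: a b)
    case 0
    then show ?case using F_eq by simp
  next
    case (Suc k)
    then show ?case
      using F_shift[of a b] Suc.IH[of "a + T" "b + T"] by (auto simp: field_simps)
  qed
  have F_all: "F a b = q * (b - a)" if "a \<le> b" for a b
  proof -
    obtain k where "- a \<le> of_nat k * T"
      using reals_Archimedean3[OF T] less_imp_le by blast
    then show ?thesis using F_eq'[of k a b] that by simp
  qed
  have eF: "emeasure lborel (Q \<inter> {a..<b}) = ennreal (q * (b - a))" if "a \<le> b" for a b
    using F_all[OF that] fin[of Q a b] emeasure_eq_ennreal_measure[of lborel "Q \<inter> {a..<b}"]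
    by (simp add: F_def)
  have q: "0 \<le> q" using F_le(1)[of 0 T] T by (simp add: q_def)
  define M where "M = density lborel (\<lambda>x. ennreal (1 / q) * indicator Q x)"
  show ?thesis
  proof (cases "q = 0")
    case True
    have "Q \<inter> {- real n..<real n} \<in> null_sets lborel" for n
      using eF[of "- real n" "real n"] True by (auto intro: null_setsI)
    then have "(\<Union>n. Q \<inter> {- real n..<real n}) \<in> null_sets lborel"
      by (rule null_sets_UN)
    moreover have "x \<in> (\<Union>n. Q \<inter> {- real n..<real n})" if "x \<in> Q" for x
    proof -
      obtain n where "\<bar>x\<bar> < real n" using reals_Archimedean2 by blast
      then have "x \<in> {- real n..<real n}" by auto
      then show ?thesis using that by blast
    qed
    ultimately have "AE x in lborel. x \<notin> Q"
      by (intro AE_I'[of "\<Union>n. Q \<inter> {- real n..<real n}"]) auto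
    then show ?thesis ..
  next
    case False
    have eM: "emeasure M A = ennreal (1 / q) * emeasure lborel (Q \<inter> A)" if "A \<in> sets borel" for A
    proof -
      have "emeasure M A = (\<integral>\<^sup>+x. ennreal (1 / q) * indicator (Q \<inter> A) x \<partial>lborel)"
        unfolding M_def using that
        by (subst emeasure_density) (auto simp: indicator_def intro!: nn_integral_cong)
      then show ?thesis
        using that by (simp add: nn_integral_cmult_indicator)
    qed
    have "lborel = M"
    proof (rule lborel_eqI)
      fix l u :: real assume le: "\<And>b. b \<in> Basis \<Longrightarrow> l \<bullet> b \<le> u \<bullet> b"
      then have "l \<le> u" by simp
      have "emeasure lborel (Q \<inter> box l u) = emeasure lborel (Q \<inter> {l..<u})"
        by (rule emeasure_eq_AE) (use AE_lborel_singleton[of l] in \<open>auto simp: box_real\<close>)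
      then have "emeasure M (box l u) = ennreal (1 / q) * ennreal (q * (u - l))"
        using eF[OF \<open>l \<le> u\<close>] by (simp add: eM)
      also have "\<dots> = ennreal (u - l)"
        using False q \<open>l \<le> u\<close> by (simp flip: ennreal_mult)
      finally show "emeasure M (box l u) = (\<Prod>b\<in>Basis. (u - l) \<bullet> b)" by simp
    qed (simp add: M_def)
    then have "emeasure lborel (- Q) = emeasure M (- Q)" by simp
    also have "\<dots> = 0" by (subst eM) auto
    finally have "- Q \<in> null_sets lborel" by (intro null_setsI) auto
    then have "AE x in lborel. x \<in> Q"
      using AE_not_in by force
    then show ?thesis ..
  qed
qed

section \<open>Uniqueness of the absolutely continuous invariant measure\<close>

text \<open>
  The set P where g1 > g2 maximises the difference of the two measures, and by invariance its preimage
  A has the same difference. So A can miss only a null set of the points of P, since g1 - g2 is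
  positive on P.
\<close>
lemma invariant_densities_forward_invariant:
  fixes g1 g2 :: "'a \<Rightarrow> ennreal"
  assumes [measurable]: "T \<in> measurable M M" "g1 \<in> borel_measurable M" "g2 \<in> borel_measurable M"
    and prob: "prob_space (density M g1)" "prob_space (density M g2)"
    and inv: "distr (density M g1) (density M g1) T = density M g1"
             "distr (density M g2) (density M g2) T = density M g2"
  shows "AE x in M. g1 x > g2 x \<longrightarrow> g1 (T x) > g2 (T x)"
proof -
  interpret m1: prob_space "density M g1" by fact
  interpret m2: prob_space "density M g2" by fact
  define P where "P = {x \<in> space M. g1 x > g2 x}"
  define A where "A = T -` P \<inter> space M"
  have [measurable]: "P \<in> sets M" "A \<in> sets M"
    unfolding P_def A_def by measurable
  let ?m1 = "measure (density M g1)" and ?m2 = "measure (density M g2)"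
  have "?m1 P = ?m1 A" "?m2 P = ?m2 A"
    using measure_distr[of T "density M g1" "density M g1" P]
      measure_distr[of T "density M g2" "density M g2" P]
    by (simp_all add: inv A_def)
  moreover have "(P \<inter> A) \<union> (P - A) = P" "(P \<inter> A) \<union> (A - P) = A"
      "(P \<inter> A) \<inter> (P - A) = {}" "(P \<inter> A) \<inter> (A - P) = {}"
    by blast+
  then have "?m1 P = ?m1 (P \<inter> A) + ?m1 (P - A)" "?m2 P = ?m2 (P \<inter> A) + ?m2 (P - A)"
    "?m1 A = ?m1 (P \<inter> A) + ?m1 (A - P)" "?m2 A = ?m2 (P \<inter> A) + ?m2 (A - P)"
    using m1.finite_measure_Union[of "P \<inter> A" "P - A"] m2.finite_measure_Union[of "P \<inter> A" "P - A"]
      m1.finite_measure_Union[of "P \<inter> A" "A - P"] m2.finite_measure_Union[of "P \<inter> A" "A - P"]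
    by simp_all
  moreover have "?m1 (A - P) \<le> ?m2 (A - P)"
  proof -
    have "emeasure (density M g1) (A - P) \<le> emeasure (density M g2) (A - P)"
      by (simp add: emeasure_density)
         (auto intro!: nn_integral_mono simp: indicator_def P_def A_def not_less)
    then show ?thesis
      by (simp add: m1.emeasure_eq_measure m2.emeasure_eq_measure)
  qed
  ultimately have "?m1 (P - A) \<le> ?m2 (P - A)" by linarith
  then have le: "(\<integral>\<^sup>+x. g1 x * indicator (P - A) x \<partial>M) \<le> (\<integral>\<^sup>+x. g2 x * indicator (P - A) x \<partial>M)"
    by (simp add: emeasure_density[symmetric] m1.emeasure_eq_measure m2.emeasure_eq_measure)
  have fin: "(\<integral>\<^sup>+x. g2 x * indicator (P - A) x \<partial>M) \<noteq> \<infinity>"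
    by (simp add: emeasure_density[symmetric] m2.emeasure_eq_measure)
  have "AE x in M. g1 x * indicator (P - A) x \<le> g2 x * indicator (P - A) x"
  proof (rule ccontr)
    assume n: "\<not> (AE x in M. g1 x * indicator (P - A) x \<le> g2 x * indicator (P - A) x)"
    have "(\<integral>\<^sup>+x. g2 x * indicator (P - A) x \<partial>M) < (\<integral>\<^sup>+x. g1 x * indicator (P - A) x \<partial>M)"
      by (rule nn_integral_less[OF _ _ fin _ n]) (auto simp: P_def indicator_def)
    then show False using le by simp
  qed
  then show ?thesis
  proof (rule AE_mp, intro AE_I2 impI)
    fix x assume x: "x \<in> space M" "g1 x * indicator (P - A) x \<le> g2 x * indicator (P - A) x" "g2 x < g1 x"
    then have "x \<in> P" by (simp add: P_def)
    then have "x \<in> A" using x by (cases "x \<in> A") (auto simp: not_le)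
    then show "g2 (T x) < g1 (T x)" by (simp add: A_def P_def)
  qed
qed

lemma density_prob_eqI:
  fixes g1 g2 :: "'a \<Rightarrow> ennreal"
  assumes [measurable]: "g1 \<in> borel_measurable M" "g2 \<in> borel_measurable M"
    and prob: "prob_space (density M g1)" "prob_space (density M g2)"
    and le: "AE x in M. g1 x \<le> g2 x"
  shows "density M g1 = density M g2"
proof -
  have int: "(\<integral>\<^sup>+x. g1 x \<partial>M) = 1" "(\<integral>\<^sup>+x. g2 x \<partial>M) = 1"
    using prob_space.emeasure_space_1[OF prob(1)] prob_space.emeasure_space_1[OF prob(2)]
    by (auto simp: emeasure_density cong: nn_integral_cong)
  have "AE x in M. g2 x \<le> g1 x"
  proof (rule ccontr)
    assume n: "\<not> (AE x in M. g2 x \<le> g1 x)"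
    have "(\<integral>\<^sup>+x. g1 x \<partial>M) < (\<integral>\<^sup>+x. g2 x \<partial>M)"
      by (rule nn_integral_less[OF _ _ _ le n]) (auto simp: int)
    then show False by (simp add: int)
  qed
  with le have "AE x in M. g1 x = g2 x" by eventually_elim simp
  then show ?thesis by (intro density_cong) auto
qed

lemma borel_measurable_d1 [measurable]: "(\<lambda>x. real_of_int (d1 x)) \<in> borel_measurable borel"
proof -
  have "(\<lambda>x. real_of_int (d1 x)) = (\<lambda>x. if x < - 1 / 2 then - 1 else if x \<le> 1 / 2 then 0 else 1)"
    by (auto simp: d1_def)
  also have "\<dots> \<in> borel_measurable borel" by measurable
  finally show ?thesis .
qed

lemma borel_measurable_sym_doubling [measurable]: "sym_doubling \<eta> \<in> borel_measurable borel"
  unfolding sym_doubling_def[abs_def] by measurable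

lemma sym_doubling_range:
  assumes "1 \<le> \<eta>" "\<eta> \<le> 2" "x \<in> {-1..1}"
  shows "sym_doubling \<eta> x \<in> {-1..1}"
  using assms by (auto simp: sym_doubling_def d1_def)

lemma measurable_sym_doubling_leb:
  assumes "1 \<le> \<eta>" "\<eta> \<le> 2"
  shows "sym_doubling \<eta> \<in> measurable leb leb"
  by (rule measurable_restrict_space3) (use sym_doubling_range[OF assms] in auto)

text \<open>
  The map is 2 x modulo \<eta>, so the \<eta>-periodic set Q generated by P is forward invariant under
  doubling, and ergodicity applies to it. A point of the middle interval has no other point of
  [-1, 1] in its class modulo \<eta>, so membership in Q means membership in P there.
\<close>
lemma forward_invariant_set_covers_middle:
  fixes P :: "real set"
  assumes \<eta>: "1 < \<eta>" and P [measurable]: "P \<in> sets borel" and sub: "P \<subseteq> {-1..1}"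
    and inv: "AE x in lborel. x \<in> P \<longrightarrow> sym_doubling \<eta> x \<in> P"
  shows "(AE x in lborel. x \<notin> P) \<or> (AE x in lborel. x \<in> {1 - \<eta><..<\<eta> - 1} \<longrightarrow> x \<in> P)"
proof -
  define Q where "Q = (\<Union>k::int. {x. x + of_int k * \<eta> \<in> P})"
  have Q [measurable]: "Q \<in> sets borel"
    unfolding Q_def by measurable
  have per: "x + \<eta> \<in> Q \<longleftrightarrow> x \<in> Q" for x
  proof
    assume "x + \<eta> \<in> Q"
    then obtain k where "x + \<eta> + of_int k * \<eta> \<in> P" by (auto simp: Q_def)
    then have "x + of_int (k + 1) * \<eta> \<in> P" by (simp add: algebra_simps)
    then show "x \<in> Q" unfolding Q_def by blast
  next
    assume "x \<in> Q"
    then obtain k where "x + of_int k * \<eta> \<in> P" by (auto simp: Q_def)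
    then have "x + \<eta> + of_int (k - 1) * \<eta> \<in> P" by (simp add: algebra_simps)
    then show "x + \<eta> \<in> Q" unfolding Q_def by blast
  qed
  have "AE x in lborel. x + of_int k * \<eta> \<in> P \<longrightarrow> sym_doubling \<eta> (x + of_int k * \<eta>) \<in> P" for k :: int
    using AE_borel_affine[of 1 "\<lambda>x. x \<in> P \<longrightarrow> sym_doubling \<eta> x \<in> P" "of_int k * \<eta>"] inv
    by (simp add: add.commute)
  then have "AE x in lborel. \<forall>k::int. x + of_int k * \<eta> \<in> P \<longrightarrow> sym_doubling \<eta> (x + of_int k * \<eta>) \<in> P"
    by (simp add: AE_all_countable)
  then have "AE x in lborel. x \<in> Q \<longrightarrow> 2 * x \<in> Q"
  proof eventually_elim
    case (elim x)
    show ?case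
    proof
      assume "x \<in> Q"
      then obtain k where "x + of_int k * \<eta> \<in> P" by (auto simp: Q_def)
      then have "sym_doubling \<eta> (x + of_int k * \<eta>) \<in> P" using elim by blast
      then have "2 * x + of_int (2 * k - d1 (x + of_int k * \<eta>)) * \<eta> \<in> P"
        by (simp add: sym_doubling_def algebra_simps)
      then show "2 * x \<in> Q" unfolding Q_def by blast
    qed
  qed
  then consider "AE x in lborel. x \<notin> Q" | "AE x in lborel. x \<in> Q"
    using periodic_doubling_zero_one[OF Q _ per] \<eta> by auto
  then show ?thesis
  proof cases
    case 1
    then have "AE x in lborel. x \<notin> P"
    proof eventually_elim
      case (elim x)
      then have "x + of_int 0 * \<eta> \<notin> P" unfolding Q_def by blast
      then show ?case by simp
    qed
    then show ?thesis ..
  next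
    case 2
    then have "AE x in lborel. x \<in> {1 - \<eta><..<\<eta> - 1} \<longrightarrow> x \<in> P"
    proof eventually_elim
      case (elim x)
      show ?case
      proof
        assume x: "x \<in> {1 - \<eta><..<\<eta> - 1}"
        obtain k where k: "x + of_int k * \<eta> \<in> P" using elim by (auto simp: Q_def)
        then have "-1 \<le> x + of_int k * \<eta>" "x + of_int k * \<eta> \<le> 1" using sub by auto
        moreover have "1 - \<eta> < x" "x < \<eta> - 1" using x by auto
        ultimately have "of_int k * \<eta> < 1 * \<eta>" "(-1) * \<eta> < of_int k * \<eta>" by linarith+
        then have "of_int k < (1::real)" "(-1::real) < of_int k"
          using \<eta> by (auto simp only: mult_less_cancel_right)
        then have "k = 0" by linarith
        then show "x \<in> P" using k by simp
      qed
    qed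
    then show ?thesis ..
  qed
qed

lemma acip_density:
  assumes "acip \<eta> \<mu>"
  obtains g where "g \<in> borel_measurable leb" "\<mu> = density leb g"
proof -
  have "sigma_finite_measure leb"
    by (intro sigma_finite_measure_restrict_space lborel.sigma_finite_measure_axioms) auto
  then show ?thesis
    using sigma_finite_measure.Radon_Nikodym[of leb \<mu>] assms that unfolding acip_def by metis
qed

lemma acip_densities_ordered:
  assumes \<eta>: "1 < \<eta>" "\<eta> \<le> 2" and "acip \<eta> (density leb g1)" "acip \<eta> (density leb g2)"
    and g: "g1 \<in> borel_measurable leb" "g2 \<in> borel_measurable leb"
  shows "(AE x in leb. g1 x \<le> g2 x) \<or> (AE x in lborel. x \<in> {1 - \<eta><..<\<eta> - 1} \<longrightarrow> g1 x > g2 x)"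
proof -
  define P where "P = {x \<in> space leb. g1 x > g2 x}"
  have "P \<in> sets leb"
    unfolding P_def using g by measurable
  then have P: "P \<in> sets borel" "P \<subseteq> {-1..1}"
    by (auto simp: sets_restrict_space_iff P_def space_restrict_space)
  have "AE x in leb. g1 x > g2 x \<longrightarrow> g1 (sym_doubling \<eta> x) > g2 (sym_doubling \<eta> x)"
    using assms measurable_sym_doubling_leb[of \<eta>] unfolding acip_def
    by (intro invariant_densities_forward_invariant) auto
  then have "AE x in lborel. x \<in> P \<longrightarrow> sym_doubling \<eta> x \<in> P"
    using sym_doubling_range[of \<eta>] \<eta>
    by (subst (asm) AE_restrict_space_iff) (auto simp: P_def space_restrict_space elim!: AE_mp)
  from forward_invariant_set_covers_middle[OF \<eta>(1) P this] show ?thesis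
  proof
    assume "AE x in lborel. x \<notin> P"
    then have "AE x in leb. g1 x \<le> g2 x"
      by (subst AE_restrict_space_iff) (auto simp: P_def space_restrict_space not_less elim!: AE_mp)
    then show ?thesis ..
  next
    assume "AE x in lborel. x \<in> {1 - \<eta><..<\<eta> - 1} \<longrightarrow> x \<in> P"
    then have "AE x in lborel. x \<in> {1 - \<eta><..<\<eta> - 1} \<longrightarrow> g1 x > g2 x"
      by eventually_elim (auto simp: P_def)
    then show ?thesis ..
  qed
qed

text \<open>
  The two densities cannot each exceed the other almost everywhere on the middle interval, so one of
  them is dominated by the other, and equal total mass makes them equal.
\<close>
lemma acip_unique:
  assumes \<eta>: "1 < \<eta>" "\<eta> \<le> 2" and \<mu>: "acip \<eta> \<mu>1" "acip \<eta> \<mu>2"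
  shows "\<mu>1 = \<mu>2"
proof -
  obtain g1 g2 where g: "g1 \<in> borel_measurable leb" "\<mu>1 = density leb g1"
    "g2 \<in> borel_measurable leb" "\<mu>2 = density leb g2"
    using acip_density \<mu> by metis
  have prob: "prob_space (density leb g1)" "prob_space (density leb g2)"
    using \<mu> g by (auto simp: acip_def)
  have "\<not> ((AE x in lborel. x \<in> {1 - \<eta><..<\<eta> - 1} \<longrightarrow> g1 x > g2 x) \<and>
           (AE x in lborel. x \<in> {1 - \<eta><..<\<eta> - 1} \<longrightarrow> g2 x > g1 x))"
  proof
    assume "(AE x in lborel. x \<in> {1 - \<eta><..<\<eta> - 1} \<longrightarrow> g1 x > g2 x) \<and>
           (AE x in lborel. x \<in> {1 - \<eta><..<\<eta> - 1} \<longrightarrow> g2 x > g1 x)"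
    then have "AE x in lborel. x \<notin> {1 - \<eta><..<\<eta> - 1}"
      by (auto elim!: AE_mp)
    then have "emeasure lborel {1 - \<eta><..<\<eta> - 1} = 0"
      by (subst (asm) AE_iff_measurable[of "{1 - \<eta><..<\<eta> - 1}"]) auto
    then show False using \<eta> by simp
  qed
  then consider "AE x in leb. g1 x \<le> g2 x" | "AE x in leb. g2 x \<le> g1 x"
    using acip_densities_ordered[OF \<eta>, of g1 g2] acip_densities_ordered[OF \<eta>, of g2 g1] \<mu> g
    by auto
  then show ?thesis
    using density_prob_eqI[OF g(1,3) prob] density_prob_eqI[OF g(3,1) prob(2,1)] g by cases auto
qed

lemma inv_measure_eqI:
  assumes "1 < \<eta>" "\<eta> \<le> 2" "acip \<eta> \<mu>"
  shows "inv_measure \<eta> = \<mu>"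
  unfolding inv_measure_def using assms acip_unique by (auto intro!: the_equality)

section \<open>The invariant density\<close>

lemma measure_Icc_eq_Ioo:
  assumes [measurable]: "A \<in> sets borel"
  shows "measure lborel (A \<inter> {a..b}) = measure lborel (A \<inter> {a<..<b::real})"
proof (rule measure_eq_AE)
  show "AE x in lborel. (x \<in> A \<inter> {a..b}) = (x \<in> A \<inter> {a<..<b})"
    using AE_lborel_singleton[of a] AE_lborel_singleton[of b] by eventually_elim auto
qed auto

lemma measure_Icc_split:
  assumes [measurable]: "A \<in> sets borel" and "a \<le> b" "b \<le> (c::real)"
  shows "measure lborel (A \<inter> {a..c}) = measure lborel (A \<inter> {a..b}) + measure lborel (A \<inter> {b..c})"
proof -
  have "emeasure lborel (A \<inter> {s..t}) \<noteq> \<infinity>" for s t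
    by (rule less_imp_neq, rule le_less_trans[OF emeasure_mono[of _ "{s..t}"]])
       (cases "s \<le> t"; simp)+
  moreover have "emeasure lborel (A \<inter> {s<..t}) \<noteq> \<infinity>" for s t
    by (rule less_imp_neq, rule le_less_trans[OF emeasure_mono[of _ "{s<..t}"]])
       (cases "s \<le> t"; simp)+
  moreover have "A \<inter> {a..c} = (A \<inter> {a..b}) \<union> (A \<inter> {b<..c})"
    using assms by auto
  ultimately have "measure lborel (A \<inter> {a..c}) = measure lborel (A \<inter> {a..b}) + measure lborel (A \<inter> {b<..c})"
    by (simp only:) (rule measure_Union; auto)
  also have "measure lborel (A \<inter> {b<..c}) = measure lborel (A \<inter> {b..c})"
  proof (rule measure_eq_AE)
    show "AE x in lborel. (x \<in> A \<inter> {b<..c}) = (x \<in> A \<inter> {b..c})"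
      using AE_lborel_singleton[of b] by eventually_elim auto
  qed auto
  finally show ?thesis .
qed

lemma measure_reflect:
  assumes [measurable]: "A \<in> sets borel"
  shows "measure lborel ({x. - x \<in> A} \<inter> {a..b}) = measure lborel (A \<inter> {-b..-a::real})"
proof -
  have "emeasure lborel (A \<inter> {-b..-a}) = emeasure (distr lborel borel uminus) (A \<inter> {-b..-a})"
    by (simp add: lborel_distr_uminus)
  also have "\<dots> = emeasure lborel ({x. - x \<in> A} \<inter> {a..b})"
    by (subst emeasure_distr) (auto intro!: arg_cong[where f = "emeasure lborel"])
  finally show ?thesis by (simp add: measure_def)
qed

text \<open>
  A piece of a single branch has slope 2, so pulling back halves the measure. The branch formula is only
  required in the interior, which makes closed intervals usable up to the discontinuities.
\<close>
lemma measure_branch_preimage: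
  assumes [measurable]: "A \<in> sets borel"
    and branch: "\<And>x. a < x \<Longrightarrow> x < b \<Longrightarrow> sym_doubling \<eta> x = 2 * x + t"
  shows "measure lborel ({x. sym_doubling \<eta> x \<in> A} \<inter> {a..b}) =
         measure lborel (A \<inter> {2 * a + t..2 * b + t}) / 2"
proof -
  let ?B = "A \<inter> {2 * a + t<..<2 * b + t}"
  have "measure lborel ({x. sym_doubling \<eta> x \<in> A} \<inter> {a..b})
      = measure lborel ({x. sym_doubling \<eta> x \<in> A} \<inter> {a<..<b})"
    by (rule measure_Icc_eq_Ioo) measurable
  also have "{x. sym_doubling \<eta> x \<in> A} \<inter> {a<..<b} = {x. 2 * x \<in> {y. y + t \<in> ?B}}"
    using branch by auto
  also have "measure lborel \<dots> = measure lborel {y. y + t \<in> ?B} / 2"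
    by (rule lborel_measure_scale) auto
  also have "measure lborel {y. y + t \<in> ?B} = measure lborel ?B"
    by (rule lborel_measure_translate) auto
  also have "measure lborel ?B = measure lborel (A \<inter> {2 * a + t..2 * b + t})"
    by (rule measure_Icc_eq_Ioo[symmetric]) auto
  finally show ?thesis .
qed

text \<open>
  The transfer of the indicator function of [y - \<eta>, y], tested on a set A, in the three positions of y.
  The interval is cut at the discontinuities and each piece is transported by its own branch. Outside
  the gap the interval is cut once, and the images of the two pieces
  add up to the next interval [S y - \<eta>, S y] plus the left or the right one of the two intervals
  [-1, \<eta> - 1] and [1 - \<eta>, 1]. In the gap the interval contains the whole middle branch, and the
  images of the two ends complete it to both of these intervals.
\<close>
lemma measure_pair_preimage:
  fixes A :: "real set" and \<eta> y :: real
  defines "I \<equiv> \<lambda>a b. measure lborel (A \<inter> {a..b})"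
  defines "J \<equiv> \<lambda>a b. measure lborel ({x. sym_doubling \<eta> x \<in> A} \<inter> {a..b})"
  assumes A: "A \<in> sets borel" and \<eta>: "1 < \<eta>" "\<eta> \<le> 2" and y: "\<eta> - 1 \<le> y" "y \<le> 1"
  shows "y \<le> 1 / 2 \<Longrightarrow> J (y - \<eta>) y = (I (2 * y - \<eta>) (2 * y) + I (-1) (\<eta> - 1)) / 2"
    and "\<eta> - 1 / 2 \<le> y \<Longrightarrow>
           J (y - \<eta>) y = (I (2 * y - \<eta> - \<eta>) (2 * y - \<eta>) + I (1 - \<eta>) 1) / 2"
    and "1 / 2 < y \<Longrightarrow> y < \<eta> - 1 / 2 \<Longrightarrow>
           J (y - \<eta>) y = (I (1 - \<eta>) 1 + I (-1) (\<eta> - 1)) / 2"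
proof -
  have [measurable]: "A \<in> sets borel" by fact
  have J_split: "J a c = J a b + J b c" if "a \<le> b" "b \<le> c" for a b c
    unfolding J_def by (rule measure_Icc_split) (use that in measurable)
  define L where "L a = I (-1) a" for a
  have I_L: "I a b = L b - L a" if "-1 \<le> a" "a \<le> b" for a b
    unfolding L_def I_def using measure_Icc_split[OF A that] by simp
  have left: "J a b = (L (2 * b + \<eta>) - L (2 * a + \<eta>)) / 2"
    if "a \<le> b" "b \<le> - 1 / 2" "-1 \<le> 2 * a + \<eta>" for a b
    using measure_branch_preimage[OF A, of a b \<eta> \<eta>] that I_L[of "2 * a + \<eta>" "2 * b + \<eta>"]
    by (simp add: sym_doubling_branch I_def J_def)
  have mid: "J a b = (L (2 * b) - L (2 * a)) / 2"
    if "a \<le> b" "b \<le> 1 / 2" "-1 / 2 \<le> a" for a b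
    using measure_branch_preimage[OF A, of a b \<eta> 0] that I_L[of "2 * a" "2 * b"]
    by (simp add: sym_doubling_branch I_def J_def)
  have right: "J a b = (L (2 * b - \<eta>) - L (2 * a - \<eta>)) / 2"
    if "a \<le> b" "1 / 2 \<le> a" for a b
    using measure_branch_preimage[OF A, of a b \<eta> "- \<eta>"] that I_L[of "2 * a - \<eta>" "2 * b - \<eta>"] \<eta>
    by (simp add: sym_doubling_branch I_def J_def)
  {
    assume "y \<le> 1 / 2"
    then show "J (y - \<eta>) y = (I (2 * y - \<eta>) (2 * y) + I (-1) (\<eta> - 1)) / 2"
      using J_split[of "y - \<eta>" "- 1 / 2" y] left[of "y - \<eta>" "- 1 / 2"] mid[of "- 1 / 2" y] \<eta> y
        I_L[of "2 * y - \<eta>" "2 * y"] I_L[of "-1" "\<eta> - 1"]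
      by (simp add: algebra_simps)
  next
    assume "\<eta> - 1 / 2 \<le> y"
    then show "J (y - \<eta>) y = (I (2 * y - \<eta> - \<eta>) (2 * y - \<eta>) + I (1 - \<eta>) 1) / 2"
    proof -
      have "J (y - \<eta>) y = J (y - \<eta>) (1 / 2) + J (1 / 2) y"
        by (rule J_split) (use \<open>\<eta> - 1 / 2 \<le> y\<close> y \<eta> in auto)
      moreover have "J (y - \<eta>) (1 / 2) = (L 1 - L (2 * y - \<eta> - \<eta>)) / 2"
        using mid[of "y - \<eta>" "1 / 2"] \<open>\<eta> - 1 / 2 \<le> y\<close> y \<eta> by (simp add: algebra_simps)
      moreover have "J (1 / 2) y = (L (2 * y - \<eta>) - L (1 - \<eta>)) / 2"
        using right[of "1 / 2" y] \<open>\<eta> - 1 / 2 \<le> y\<close> \<eta> by simp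
      moreover have "I (2 * y - \<eta> - \<eta>) (2 * y - \<eta>) = L (2 * y - \<eta>) - L (2 * y - \<eta> - \<eta>)"
        "I (1 - \<eta>) 1 = L 1 - L (1 - \<eta>)"
        by (rule I_L; use \<open>\<eta> - 1 / 2 \<le> y\<close> y \<eta> in simp)+
      ultimately show ?thesis by argo
    qed
  next
    assume "1 / 2 < y" "y < \<eta> - 1 / 2"
    then have "J (y - \<eta>) y = J (y - \<eta>) (- 1 / 2) + (J (- 1 / 2) (1 / 2) + J (1 / 2) y)"
      using J_split[of "y - \<eta>" "- 1 / 2" y] J_split[of "- 1 / 2" "1 / 2" y] by simp
    moreover have "J (y - \<eta>) (- 1 / 2) = (L (\<eta> - 1) - L (2 * y - \<eta>)) / 2"
      using left[of "y - \<eta>" "- 1 / 2"] \<open>y < \<eta> - 1 / 2\<close> y \<eta> by (simp add: algebra_simps)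
    moreover have "J (- 1 / 2) (1 / 2) = (L 1 - L (-1)) / 2"
      using mid[of "- 1 / 2" "1 / 2"] by simp
    moreover have "J (1 / 2) y = (L (2 * y - \<eta>) - L (1 - \<eta>)) / 2"
      using right[of "1 / 2" y] \<open>1 / 2 < y\<close> by simp
    moreover have "I (-1) (\<eta> - 1) = L (\<eta> - 1) - L (-1)" "I (1 - \<eta>) 1 = L 1 - L (1 - \<eta>)"
      by (rule I_L; use \<eta> in simp)+
    ultimately show "J (y - \<eta>) y = (I (1 - \<eta>) 1 + I (-1) (\<eta> - 1)) / 2" by argo
  }
qed

text \<open>
  The mass that the n-th summand of the invariant density, together with its mirror image, gives to A.
\<close>
definition pair_mass :: "real \<Rightarrow> nat \<Rightarrow> real set \<Rightarrow> real" where
  "pair_mass \<eta> n A = measure lborel (A \<inter> {orbit \<eta> n - \<eta>..orbit \<eta> n}) +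
                      measure lborel (A \<inter> {- orbit \<eta> n..\<eta> - orbit \<eta> n})"

text \<open>
  Adding the mirror image makes the recursion uniform: the correction is always the sum of the
  left and the right interval, which is the summand for n = 0, no matter which branch y is on.
\<close>
lemma pair_mass_preimage:
  assumes A: "A \<in> sets borel" and \<eta>: "1 < \<eta>" "\<eta> \<le> 2" and before: "\<forall>j<n. \<not> in_gap \<eta> j"
  shows "pair_mass \<eta> n {x. sym_doubling \<eta> x \<in> A} =
           (if in_gap \<eta> n then pair_mass \<eta> 0 A
            else (pair_mass \<eta> (Suc n) A + pair_mass \<eta> 0 A) / 2)"
proof -
  let ?y = "orbit \<eta> n"
  define A' where "A' = {x. - x \<in> A}"
  have A': "A' \<in> sets borel" unfolding A'_def using A by measurable
  have S: "{x. sym_doubling \<eta> x \<in> A} \<in> sets borel" using A by measurable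
  have y: "\<eta> - 1 \<le> ?y" "?y \<le> 1"
    using orbits_before_gap[OF \<eta> before] by auto
  have "{x. sym_doubling \<eta> x \<in> A'} = {x. - x \<in> {x. sym_doubling \<eta> x \<in> A}}"
    by (simp add: A'_def sym_doubling_uminus)
  then have mirror: "measure lborel ({x. sym_doubling \<eta> x \<in> A'} \<inter> {a..b}) =
      measure lborel ({x. sym_doubling \<eta> x \<in> A} \<inter> {-b..-a})"
    "measure lborel (A' \<inter> {a..b}) = measure lborel (A \<inter> {-b..-a})" for a b
    using measure_reflect[OF S] measure_reflect[OF A] by (simp_all add: A'_def)
  consider "?y \<le> 1 / 2" | "\<eta> - 1 / 2 \<le> ?y" | "1 / 2 < ?y" "?y < \<eta> - 1 / 2" by linarith
  then show ?thesis
  proof cases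
    case 1
    then have "orbit \<eta> (Suc n) = 2 * ?y" "\<not> in_gap \<eta> n"
      using y \<eta> by (auto simp: orbit_Suc sym_doubling_branch in_gap_def)
    then show ?thesis
      using measure_pair_preimage(1)[OF A \<eta> y 1] measure_pair_preimage(1)[OF A' \<eta> y 1]
      unfolding mirror pair_mass_def by simp
  next
    case 2
    then have "orbit \<eta> (Suc n) = 2 * ?y - \<eta>" "\<not> in_gap \<eta> n"
      using y \<eta> by (auto simp: orbit_Suc sym_doubling_branch in_gap_def)
    then show ?thesis
      using measure_pair_preimage(2)[OF A \<eta> y 2] measure_pair_preimage(2)[OF A' \<eta> y 2]
      unfolding mirror pair_mass_def by simp
  next
    case 3
    then have "in_gap \<eta> n" by (simp add: in_gap_def)
    then show ?thesis
      using measure_pair_preimage(3)[OF A \<eta> y 3] measure_pair_preimage(3)[OF A' \<eta> y 3]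
      unfolding mirror pair_mass_def by simp
  qed
qed

text \<open>
  The halves of the first summand that split off at times n < N have total weight 1 - 1 / 2^N, and the
  last step returns the missing 1 / 2^N.
\<close>
lemma weighted_sum_telescope:
  fixes U V :: "nat \<Rightarrow> real"
  assumes "\<forall>n<N. V n = (U (Suc n) + U 0) / 2" and "V N = U 0"
  shows "(\<Sum>n\<le>N. V n / 2 ^ n) = (\<Sum>n\<le>N. U n / 2 ^ n)"
proof -
  have "(\<Sum>n<k. V n / 2 ^ n) = (\<Sum>n\<le>k. U n / 2 ^ n) - U 0 / 2 ^ k" if "k \<le> N" for k
    using that
  proof (induction k)
    case (Suc k)
    then have "V k = (U (Suc k) + U 0) / 2" using assms(1) by auto
    then have "V k / 2 ^ k = U (Suc k) / 2 ^ Suc k + U 0 / 2 ^ Suc k" "U 0 / 2 ^ k = 2 * (U 0 / 2 ^ Suc k)"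
      by (simp_all add: field_simps)
    moreover have "(\<Sum>n<k. V n / 2 ^ n) = (\<Sum>n\<le>k. U n / 2 ^ n) - U 0 / 2 ^ k" using Suc by simp
    ultimately show ?case by (simp only: sum.lessThan_Suc sum.atMost_Suc)
  qed simp
  from this[of N] show ?thesis
    using assms(2) by (simp add: lessThan_Suc_atMost[symmetric])
qed

lemma pair_mass_sum_invariant:
  assumes "A \<in> sets borel" "1 < \<eta>" "\<eta> \<le> 2" "first_entry \<eta> N"
  shows "(\<Sum>n\<le>N. pair_mass \<eta> n {x. sym_doubling \<eta> x \<in> A} / 2 ^ n) = (\<Sum>n\<le>N. pair_mass \<eta> n A / 2 ^ n)"
  using assms(4) pair_mass_preimage[OF assms(1-3)]
  by (intro weighted_sum_telescope) (auto simp: first_entry_def)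

text \<open>
  The denominator is the total mass. Closed intervals make the function continuous at the end points -1 and 1
  of the domain.
\<close>
definition inv_density :: "real \<Rightarrow> nat \<Rightarrow> real \<Rightarrow> real" where
  "inv_density \<eta> N x =
     (\<Sum>n\<le>N. (indicator {orbit \<eta> n - \<eta>..orbit \<eta> n} x +
              indicator {- orbit \<eta> n..\<eta> - orbit \<eta> n} x) / 2 ^ n) / (\<Sum>n\<le>N. 2 * \<eta> / 2 ^ n)"

lemma inv_density_nonneg: "\<eta> \<ge> 0 \<Longrightarrow> 0 \<le> inv_density \<eta> N x"
  unfolding inv_density_def by (intro divide_nonneg_nonneg sum_nonneg) auto

lemma borel_measurable_inv_density [measurable]: "inv_density \<eta> N \<in> borel_measurable borel"
  unfolding inv_density_def[abs_def] by measurable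

lemma emeasure_inv_density:
  assumes A [measurable]: "A \<in> sets borel" and sub: "A \<subseteq> {-1..1}" and \<eta>: "\<eta> \<ge> 0"
  shows "emeasure (density leb (\<lambda>x. ennreal (inv_density \<eta> N x))) A =
         ennreal ((\<Sum>n\<le>N. pair_mass \<eta> n A / 2 ^ n) / (\<Sum>n\<le>N. 2 * \<eta> / 2 ^ n))"
proof -
  have fin: "emeasure lborel (A \<inter> {a..b}) < \<infinity>" for a b
    by (rule le_less_trans[OF emeasure_mono[of _ "{a..b}"]]) (cases "a \<le> b"; simp)+
  have "has_bochner_integral lborel
     (\<lambda>x. (\<Sum>n\<le>N. (indicator (A \<inter> {orbit \<eta> n - \<eta>..orbit \<eta> n}) x +
              indicator (A \<inter> {- orbit \<eta> n..\<eta> - orbit \<eta> n}) x) / 2 ^ n) / (\<Sum>n\<le>N. 2 * \<eta> / 2 ^ n))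
     ((\<Sum>n\<le>N. pair_mass \<eta> n A / 2 ^ n) / (\<Sum>n\<le>N. 2 * \<eta> / 2 ^ n))"
    unfolding pair_mass_def
    by (intro has_bochner_integral_divide_zero has_bochner_integral_sum has_bochner_integral_add
          has_bochner_integral_real_indicator fin) auto
  also have "(\<lambda>x. (\<Sum>n\<le>N. (indicator (A \<inter> {orbit \<eta> n - \<eta>..orbit \<eta> n}) x +
              indicator (A \<inter> {- orbit \<eta> n..\<eta> - orbit \<eta> n}) x) / 2 ^ n) / (\<Sum>n\<le>N. 2 * \<eta> / 2 ^ n))
      = (\<lambda>x. inv_density \<eta> N x * indicator A x)"
    by (auto simp: inv_density_def indicator_def)
  finally have int: "has_bochner_integral lborel (\<lambda>x. inv_density \<eta> N x * indicator A x)
     ((\<Sum>n\<le>N. pair_mass \<eta> n A / 2 ^ n) / (\<Sum>n\<le>N. 2 * \<eta> / 2 ^ n))" .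
  have "A \<in> sets leb" using sub by (auto simp: sets_restrict_space_iff)
  then have "emeasure (density leb (\<lambda>x. ennreal (inv_density \<eta> N x))) A =
      (\<integral>\<^sup>+x. ennreal (inv_density \<eta> N x) * indicator A x \<partial>leb)"
    by (intro emeasure_density measurable_restrict_space1) auto
  also have "\<dots> = (\<integral>\<^sup>+x. ennreal (inv_density \<eta> N x * indicator A x) \<partial>lborel)"
    using sub by (subst nn_integral_restrict_space) (auto intro!: nn_integral_cong simp: indicator_def)
  also have "\<dots> = ennreal (\<integral>x. inv_density \<eta> N x * indicator A x \<partial>lborel)"
    using int inv_density_nonneg[OF \<eta>]
    by (intro nn_integral_eq_integral) (auto simp: has_bochner_integral_iff)
  finally show ?thesis
    using int by (simp add: has_bochner_integral_integral_eq)
qed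

lemma acip_inv_density:
  assumes \<eta>: "1 < \<eta>" "\<eta> \<le> 2" and fe: "first_entry \<eta> N"
  shows "acip \<eta> (density leb (\<lambda>x. ennreal (inv_density \<eta> N x)))" (is "acip \<eta> ?\<mu>")
  unfolding acip_def
proof (intro conjI)
  have bounds: "\<eta> - 1 \<le> orbit \<eta> n" "orbit \<eta> n \<le> 1" if "n \<le> N" for n
    using orbits_before_gap[OF \<eta>, of n] fe that by (auto simp: first_entry_def)
  have sp: "space ?\<mu> = {-1..1}" "space leb = {-1..1}" by (simp_all add: space_restrict_space)
  have pos: "0 < (\<Sum>n\<le>N. 2 * \<eta> / 2 ^ n)"
    using \<eta> by (intro sum_pos) auto
  show "prob_space ?\<mu>"
  proof
    have "pair_mass \<eta> n {-1..1} = 2 * \<eta>" if "n \<le> N" for n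
    proof -
      have "{-1..1} \<inter> {orbit \<eta> n - \<eta>..orbit \<eta> n} = {orbit \<eta> n - \<eta>..orbit \<eta> n}"
        "{-1..1} \<inter> {- orbit \<eta> n..\<eta> - orbit \<eta> n} = {- orbit \<eta> n..\<eta> - orbit \<eta> n}"
        using bounds[OF that] by auto
      then show ?thesis using \<eta> by (simp add: pair_mass_def)
    qed
    then show "emeasure ?\<mu> (space ?\<mu>) = 1"
      using \<eta> pos by (simp add: sp emeasure_inv_density)
  qed
  show "sets ?\<mu> = sets leb" by simp
  have meas: "sym_doubling \<eta> \<in> measurable ?\<mu> ?\<mu>"
    using measurable_sym_doubling_leb[of \<eta>] \<eta> by simp
  show "distr ?\<mu> ?\<mu> (sym_doubling \<eta>) = ?\<mu>"
  proof (rule measure_eqI)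
    fix A assume "A \<in> sets (distr ?\<mu> ?\<mu> (sym_doubling \<eta>))"
    then have A: "A \<in> sets ?\<mu>" and A' [measurable]: "A \<in> sets borel" and sub: "A \<subseteq> {-1..1}"
      by (auto simp: sets_restrict_space_iff)
    define B where "B = {x. sym_doubling \<eta> x \<in> A} \<inter> {-1..1}"
    have B: "B \<in> sets borel" "B \<subseteq> {-1..1}" unfolding B_def by auto
    have "pair_mass \<eta> n B = pair_mass \<eta> n {x. sym_doubling \<eta> x \<in> A}" if "n \<le> N" for n
    proof -
      have "B \<inter> {orbit \<eta> n - \<eta>..orbit \<eta> n} = {x. sym_doubling \<eta> x \<in> A} \<inter> {orbit \<eta> n - \<eta>..orbit \<eta> n}"
        "B \<inter> {- orbit \<eta> n..\<eta> - orbit \<eta> n} = {x. sym_doubling \<eta> x \<in> A} \<inter> {- orbit \<eta> n..\<eta> - orbit \<eta> n}"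
        using bounds[OF that] by (auto simp: B_def)
      then show ?thesis by (simp add: pair_mass_def)
    qed
    then have "(\<Sum>n\<le>N. pair_mass \<eta> n B / 2 ^ n) = (\<Sum>n\<le>N. pair_mass \<eta> n A / 2 ^ n)"
      using pair_mass_sum_invariant[OF A' \<eta> fe] by simp
    then have "emeasure ?\<mu> B = emeasure ?\<mu> A"
      using \<eta> A' sub B by (simp add: emeasure_inv_density)
    moreover have "emeasure (distr ?\<mu> ?\<mu> (sym_doubling \<eta>)) A = emeasure ?\<mu> B"
      using A by (subst emeasure_distr[OF meas]) (auto simp: B_def sp vimage_def)
    ultimately show "emeasure (distr ?\<mu> ?\<mu> (sym_doubling \<eta>)) A = emeasure ?\<mu> A" by simp
  qed simp
  show "absolutely_continuous leb ?\<mu>"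
    by (intro absolutely_continuousI_density measurable_compose[OF _ measurable_ennreal]
          measurable_restrict_space1) auto
qed

lemma inv_measure_first_entry:
  assumes "1 < \<eta>" "\<eta> \<le> 2" "first_entry \<eta> N"
  shows "inv_measure \<eta> = density leb (\<lambda>x. ennreal (inv_density \<eta> N x))"
  using assms acip_inv_density by (intro inv_measure_eqI)

section \<open>Jumps of the invariant density\<close>

lemma eventually_nhds_same_side_of_two:
  fixes x a b :: real
  shows "eventually (\<lambda>z. (a < x \<longrightarrow> a < z) \<and> (x < a \<longrightarrow> z < a) \<and> (b < x \<longrightarrow> b < z) \<and> (x < b \<longrightarrow> z < b)) (nhds x)"
proof -
  have "eventually (\<lambda>z. (c < x \<longrightarrow> c < z) \<and> (x < c \<longrightarrow> z < c)) (nhds x)" for c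
    by (cases c x rule: linorder_cases)
       (auto intro: eventually_nhds_in_open[of "{c<..}", simplified] eventually_nhds_in_open[of "{..<c}", simplified])
  from this[of a] this[of b] show ?thesis by eventually_elim auto
qed

lemma tendsto_indicator_at_left:
  "((indicator {a..b} :: real \<Rightarrow> real) \<longlongrightarrow> of_bool (a < x \<and> x \<le> b)) (at_left x)"
  by (rule tendsto_eventually, unfold eventually_at_filter)
     (use eventually_nhds_same_side_of_two[of a x b] in \<open>eventually_elim, auto simp: indicator_def\<close>)

lemma tendsto_indicator_at_right:
  "((indicator {a..b} :: real \<Rightarrow> real) \<longlongrightarrow> of_bool (a \<le> x \<and> x < b)) (at_right x)"
  by (rule tendsto_eventually, unfold eventually_at_filter)
     (use eventually_nhds_same_side_of_two[of a x b] in \<open>eventually_elim, auto simp: indicator_def\<close>)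

text \<open>
  The derivatives from the first one on vanish on the open set, but their values elsewhere are
  unknown; so the induction is about local constancy near each point.
\<close>
lemma locally_constant_higher_deriv:
  fixes h :: "real \<Rightarrow> real"
  assumes U: "open U" and h: "\<And>x. x \<in> U \<Longrightarrow> eventually (\<lambda>z. h z = h x) (nhds x)"
  shows "(deriv ^^ k) h differentiable_on U"
proof -
  have const: "\<exists>c. eventually (\<lambda>z. (deriv ^^ k) h z = c) (nhds x)" if "x \<in> U" for x
    using that
  proof (induction k arbitrary: x)
    case 0
    then show ?case using h by auto
  next
    case (Suc k)
    then obtain c where "eventually (\<lambda>z. (deriv ^^ k) h z = c) (nhds x)" by blast
    then have "eventually (\<lambda>z. eventually (\<lambda>w. (deriv ^^ k) h w = c) (nhds z)) (nhds x)"
      by (simp add: eventually_eventually)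
    then have "eventually (\<lambda>z. (deriv ^^ Suc k) h z = 0) (nhds x)"
    proof eventually_elim
      case (elim z)
      then have "deriv ((deriv ^^ k) h) z = deriv (\<lambda>_. c) z" by (intro deriv_cong_ev) auto
      then show ?case by simp
    qed
    then show ?case by blast
  qed
  show ?thesis
    unfolding differentiable_on_def
  proof
    fix x assume "x \<in> U"
    then obtain c where "eventually (\<lambda>z. (deriv ^^ k) h z = c) (nhds x)" using const by blast
    then have "((deriv ^^ k) h has_field_derivative 0) (at x)"
      by (subst DERIV_cong_ev[OF refl _ refl]) auto
    then show "(deriv ^^ k) h differentiable at x within U"
      using field_differentiable_at_within field_differentiable_def field_differentiable_imp_differentiable
      by blast
  qed
qed

definition breakpoints :: "real \<Rightarrow> nat \<Rightarrow> real set" where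
  "breakpoints \<eta> N = (\<Union>n\<le>N. {orbit \<eta> n, \<eta> - orbit \<eta> n, - orbit \<eta> n, orbit \<eta> n - \<eta>})"

text \<open>
  Since the points y(n) and \<eta> - y(n) lie in (0, 1], all summands have their left end points on the
  negative and their right end points on the positive half axis. At a positive break point the
  right-hand limit is therefore termwise at most the left-hand one, and strictly smaller in some term;
  at a negative one it is the other way round.
\<close>
lemma piecewise_smooth_inv_density:
  assumes \<eta>: "1 < \<eta>" "\<eta> \<le> 2" and fe: "first_entry \<eta> N"
  shows "piecewise_smooth_density (density leb (\<lambda>x. ennreal (inv_density \<eta> N x)))
           (breakpoints \<eta> N \<inter> {-1<..<1})"
proof -
  let ?D = "breakpoints \<eta> N \<inter> {-1<..<1}" and ?h = "inv_density \<eta> N"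
  define c where "c = (\<Sum>n\<le>N. 2 * \<eta> / 2 ^ n)"
  have c: "0 < c" unfolding c_def using \<eta> by (intro sum_pos) auto
  have bounds: "0 < orbit \<eta> n" "0 < \<eta> - orbit \<eta> n" "orbit \<eta> n \<le> 1" "\<eta> - orbit \<eta> n \<le> 1" if "n \<le> N" for n
    using orbits_before_gap[OF \<eta>, of n] fe that \<eta> by (auto simp: first_entry_def)
  have fin: "finite ?D" by (simp add: breakpoints_def)
  have const: "eventually (\<lambda>z. ?h z = ?h x) (at x within {-1..1})" if x: "x \<in> {-1..1} - ?D" for x
  proof -
    have "eventually (\<lambda>z. indicator {orbit \<eta> n - \<eta>..orbit \<eta> n} z = (indicator {orbit \<eta> n - \<eta>..orbit \<eta> n} x :: real)
        \<and> indicator {- orbit \<eta> n..\<eta> - orbit \<eta> n} z = (indicator {- orbit \<eta> n..\<eta> - orbit \<eta> n} x :: real))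
        (at x within {-1..1})" if n: "n \<le> N" for n
      unfolding eventually_at_filter
      using eventually_nhds_same_side_of_two[of "orbit \<eta> n - \<eta>" x "orbit \<eta> n"]
        eventually_nhds_same_side_of_two[of "- orbit \<eta> n" x "\<eta> - orbit \<eta> n"]
    proof eventually_elim
      case (elim z)
      have "x = 1 \<or> x = -1 \<or> (x \<noteq> orbit \<eta> n \<and> x \<noteq> \<eta> - orbit \<eta> n \<and> x \<noteq> - orbit \<eta> n \<and> x \<noteq> orbit \<eta> n - \<eta>)"
        using x n by (auto simp: breakpoints_def)
      then have "(orbit \<eta> n - \<eta> \<le> z) = (orbit \<eta> n - \<eta> \<le> x)" "(z \<le> orbit \<eta> n) = (x \<le> orbit \<eta> n)"
        "(- orbit \<eta> n \<le> z) = (- orbit \<eta> n \<le> x)" "(z \<le> \<eta> - orbit \<eta> n) = (x \<le> \<eta> - orbit \<eta> n)"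
        if "-1 \<le> z" "z \<le> 1"
        using elim bounds[OF n] that by (smt (verit))+
      then show ?case
        by (simp add: indicator_def)
    qed
    then have "eventually (\<lambda>z. \<forall>n\<in>{..N}. indicator {orbit \<eta> n - \<eta>..orbit \<eta> n} z = (indicator {orbit \<eta> n - \<eta>..orbit \<eta> n} x :: real)
        \<and> indicator {- orbit \<eta> n..\<eta> - orbit \<eta> n} z = (indicator {- orbit \<eta> n..\<eta> - orbit \<eta> n} x :: real))
        (at x within {-1..1})"
      by (intro eventually_ball_finite) auto
    then show ?thesis
      by eventually_elim (simp add: inv_density_def)
  qed
  have "continuous_on ({-1..1} - ?D) ?h"
    unfolding continuous_on_def
  proof
    fix x assume "x \<in> {-1..1} - ?D"
    then have "(?h \<longlongrightarrow> ?h x) (at x within {-1..1})"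
      by (intro tendsto_eventually const)
    then show "(?h \<longlongrightarrow> ?h x) (at x within {-1..1} - ?D)"
      by (rule tendsto_within_subset) auto
  qed
  moreover have "(deriv ^^ k) ?h differentiable_on ({-1<..<1} - ?D)" for k
  proof (rule locally_constant_higher_deriv)
    show "open ({-1<..<1} - ?D)"
      using finite_imp_closed[OF fin] by (intro open_Diff) auto
    fix x assume x: "x \<in> {-1<..<1} - ?D"
    then have "eventually (\<lambda>z. ?h z = ?h x) (at x within {-1..1})"
      by (intro const) auto
    then show "eventually (\<lambda>z. ?h z = ?h x) (nhds x)"
      using x by (simp add: at_within_Icc_at eventually_nhds_conv_at)
  qed
  moreover have "jump_at ?h x" if x: "x \<in> ?D" for x
  proof -
    define l where "l n = (of_bool (orbit \<eta> n - \<eta> < x \<and> x \<le> orbit \<eta> n) +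
      of_bool (- orbit \<eta> n < x \<and> x \<le> \<eta> - orbit \<eta> n) :: real) / 2 ^ n" for n
    define r where "r n = (of_bool (orbit \<eta> n - \<eta> \<le> x \<and> x < orbit \<eta> n) +
      of_bool (- orbit \<eta> n \<le> x \<and> x < \<eta> - orbit \<eta> n) :: real) / 2 ^ n" for n
    obtain n where n: "n \<le> N" "x = orbit \<eta> n \<or> x = \<eta> - orbit \<eta> n \<or> x = - orbit \<eta> n \<or> x = orbit \<eta> n - \<eta>"
      using x by (auto simp: breakpoints_def)
    have lim: "(?h \<longlongrightarrow> (\<Sum>n\<le>N. l n) / c) (at_left x)" "(?h \<longlongrightarrow> (\<Sum>n\<le>N. r n) / c) (at_right x)"
      unfolding inv_density_def[abs_def] c_def[symmetric] l_def r_def using c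
      by (intro tendsto_intros tendsto_indicator_at_left tendsto_indicator_at_right; simp)+
    have "x \<noteq> 0" using n bounds[OF n(1)] by auto
    then consider "x > 0" | "x < 0" by linarith
    then have "(\<Sum>n\<le>N. l n) \<noteq> (\<Sum>n\<le>N. r n)"
    proof cases
      case 1
      have "r k \<le> l k" if "k \<le> N" for k
        unfolding l_def r_def using 1 bounds[OF that]
        by (intro divide_right_mono add_mono) (auto simp: of_bool_def)
      moreover have "r n < l n"
        unfolding l_def r_def using 1 n bounds[OF n(1)]
        by (intro divide_strict_right_mono) (auto simp: of_bool_def)
      ultimately have "(\<Sum>n\<le>N. r n) < (\<Sum>n\<le>N. l n)"
        using n(1) by (intro sum_strict_mono_ex1) auto
      then show ?thesis by simp
    next
      case 2
      have "l k \<le> r k" if "k \<le> N" for k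
        unfolding l_def r_def using 2 bounds[OF that]
        by (intro divide_right_mono add_mono) (auto simp: of_bool_def)
      moreover have "l n < r n"
        unfolding l_def r_def using 2 n bounds[OF n(1)]
        by (intro divide_strict_right_mono) (auto simp: of_bool_def)
      ultimately have "(\<Sum>n\<le>N. l n) < (\<Sum>n\<le>N. r n)"
        using n(1) by (intro sum_strict_mono_ex1) auto
      then show ?thesis by simp
    qed
    then show ?thesis
      unfolding jump_at_def using c
      by (intro exI[of _ "(\<Sum>n\<le>N. l n) / c"] exI[of _ "(\<Sum>n\<le>N. r n) / c"] conjI lim) simp
  qed
  ultimately show ?thesis
    unfolding piecewise_smooth_density_def using fin inv_density_nonneg[of \<eta> N] \<eta>
    by (intro conjI exI[of _ ?h]) auto
qed

text \<open>
  An enumeration, by k \<le> 2 N, of the points \<eta> - y(j) for j \<le> N (even k) and y(j) for 1 \<le> j \<le> N (odd k).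
  The point y(0) = 1 is left out because it is an end point of the domain.
\<close>
definition pos_breakpoint :: "real \<Rightarrow> nat \<Rightarrow> real" where
  "pos_breakpoint \<eta> k = (if even k then \<eta> - orbit \<eta> (k div 2) else orbit \<eta> (Suc k div 2))"

definition breakpoint :: "nat \<Rightarrow> nat \<Rightarrow> real \<Rightarrow> real" where
  "breakpoint N i \<eta> = (if i < 2 * N + 1 then pos_breakpoint \<eta> i else - pos_breakpoint \<eta> (i - (2 * N + 1)))"

lemma breakpoint_image:
  "{breakpoint N i \<eta> | i. i < 4 * N + 2} \<inter> {-1<..<1} = breakpoints \<eta> N \<inter> {-1<..<1}"
proof -
  have pos: "pos_breakpoint \<eta> ` {..<2 * N + 1} = (\<lambda>j. \<eta> - orbit \<eta> j) ` {..N} \<union> orbit \<eta> ` {1..N}"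
  proof (intro equalityI subsetI)
    fix x assume "x \<in> pos_breakpoint \<eta> ` {..<2 * N + 1}"
    then obtain k where "k < 2 * N + 1" "x = pos_breakpoint \<eta> k" by blast
    then show "x \<in> (\<lambda>j. \<eta> - orbit \<eta> j) ` {..N} \<union> orbit \<eta> ` {1..N}"
      by (cases "even k") (auto simp: pos_breakpoint_def elim!: evenE oddE)
  next
    fix x assume "x \<in> (\<lambda>j. \<eta> - orbit \<eta> j) ` {..N} \<union> orbit \<eta> ` {1..N}"
    then consider j where "j \<le> N" "x = \<eta> - orbit \<eta> j" | j where "1 \<le> j" "j \<le> N" "x = orbit \<eta> j"
      by auto
    then show "x \<in> pos_breakpoint \<eta> ` {..<2 * N + 1}"
    proof cases
      case 1
      then show ?thesis by (intro image_eqI[of _ _ "2 * j"]) (auto simp: pos_breakpoint_def)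
    next
      case 2
      then show ?thesis by (intro image_eqI[of _ _ "2 * j - 1"]) (auto simp: pos_breakpoint_def)
    qed
  qed
  have "{breakpoint N i \<eta> | i. i < 4 * N + 2}
      = pos_breakpoint \<eta> ` {..<2 * N + 1} \<union> uminus ` pos_breakpoint \<eta> ` {..<2 * N + 1}"
  proof (intro equalityI subsetI)
    fix x assume "x \<in> {breakpoint N i \<eta> | i. i < 4 * N + 2}"
    then obtain i where "i < 4 * N + 2" "x = breakpoint N i \<eta>" by blast
    then show "x \<in> pos_breakpoint \<eta> ` {..<2 * N + 1} \<union> uminus ` pos_breakpoint \<eta> ` {..<2 * N + 1}"
      by (cases "i < 2 * N + 1") (auto simp: breakpoint_def)
  next
    fix x assume "x \<in> pos_breakpoint \<eta> ` {..<2 * N + 1} \<union> uminus ` pos_breakpoint \<eta> ` {..<2 * N + 1}"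
    then consider k where "k < 2 * N + 1" "x = pos_breakpoint \<eta> k" | k where "k < 2 * N + 1" "x = - pos_breakpoint \<eta> k"
      by auto
    then show "x \<in> {breakpoint N i \<eta> | i. i < 4 * N + 2}"
    proof cases
      case 1
      then have "k < 4 * N + 2 \<and> x = breakpoint N k \<eta>" by (simp add: breakpoint_def)
      then show ?thesis by blast
    next
      case 2
      then have "k + (2 * N + 1) < 4 * N + 2 \<and> x = breakpoint N (k + (2 * N + 1)) \<eta>"
        by (simp add: breakpoint_def)
      then show ?thesis by blast
    qed
  qed
  then have *: "{breakpoint N i \<eta> | i. i < 4 * N + 2} = (\<lambda>j. \<eta> - orbit \<eta> j) ` {..N} \<union> orbit \<eta> ` {1..N}
      \<union> ((\<lambda>j. orbit \<eta> j - \<eta>) ` {..N} \<union> (\<lambda>j. - orbit \<eta> j) ` {1..N})"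
    unfolding pos by (simp add: image_Un image_image)
  have "{..N} = insert 0 {1..N}" by auto
  then have start: "orbit \<eta> ` {..N} = insert 1 (orbit \<eta> ` {1..N})"
    "(\<lambda>j. - orbit \<eta> j) ` {..N} = insert (- 1) ((\<lambda>j. - orbit \<eta> j) ` {1..N})"
    by simp_all
  have "breakpoints \<eta> N = orbit \<eta> ` {..N} \<union> (\<lambda>j. \<eta> - orbit \<eta> j) ` {..N}
      \<union> (\<lambda>j. - orbit \<eta> j) ` {..N} \<union> (\<lambda>j. orbit \<eta> j - \<eta>) ` {..N}"
    unfolding breakpoints_def by blast
  then have "breakpoints \<eta> N = {breakpoint N i \<eta> | i. i < 4 * N + 2} \<union> {1, - 1}"
    unfolding * start by (simp only: Un_insert_left Un_insert_right Un_ac Un_empty_left Un_empty_right insert_commute)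
  then show ?thesis by auto
qed

text \<open>
  A coincidence y(i) = y(j) is a return and y(j) = \<eta> - y(i) is a mirror meeting; both are impossible
  for different i and j. For i = j the second one says y(j) = \<eta>/2, which is the centre of the gap, so
  j = N. Comparing with y(0) = 1 in the same way shows that no break point lies at 1.
\<close>
lemma card_breakpoint:
  assumes \<eta>: "1 < \<eta>" "\<eta> \<le> 2" and fe: "first_entry \<eta> N" and ne: "orbit \<eta> N \<noteq> \<eta> / 2"
  shows "card ({breakpoint N i \<eta> | i. i < 4 * N + 2} \<inter> {-1<..<1}) = 4 * N + 2"
proof -
  have bounds: "0 < orbit \<eta> j" "0 < \<eta> - orbit \<eta> j" "orbit \<eta> j \<le> 1" "\<eta> - orbit \<eta> j \<le> 1" if "j \<le> N" for j
    using orbits_before_gap[OF \<eta>, of j] fe that \<eta> by (auto simp: first_entry_def)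
  have return: "i = j" if "orbit \<eta> i = orbit \<eta> j" "i \<le> N" "j \<le> N" for i j
    using orbit_no_return_before_entry[OF fe, of i j] orbit_no_return_before_entry[OF fe, of j i] that
    by (metis linorder_neqE_nat)
  have mirror: "orbit \<eta> j \<noteq> \<eta> - orbit \<eta> i" if "i \<le> N" "j \<le> N" for i j
  proof
    assume eq: "orbit \<eta> j = \<eta> - orbit \<eta> i"
    then have "i = j"
      using orbit_no_mirror_before_entry[OF \<eta> fe, of i j] orbit_no_mirror_before_entry[OF \<eta> fe, of j i] that
      by (cases i j rule: linorder_cases) auto
    then have "in_gap \<eta> j" using eq \<eta> by (auto simp: in_gap_def)
    then have "j = N" using fe that by (auto simp: first_entry_def le_less)
    then show False using ne eq \<open>i = j\<close> by auto
  qed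
  have pos: "0 < pos_breakpoint \<eta> k" "pos_breakpoint \<eta> k < 1" if k: "k < 2 * N + 1" for k
  proof -
    have h: "k div 2 \<le> N" "odd k \<Longrightarrow> Suc k div 2 \<le> N" "odd k \<Longrightarrow> Suc k div 2 \<noteq> 0"
      using k by (auto elim!: oddE)
    show "0 < pos_breakpoint \<eta> k"
      using h bounds by (auto simp: pos_breakpoint_def)
    have "\<eta> - orbit \<eta> (k div 2) \<noteq> orbit \<eta> 0" "odd k \<Longrightarrow> orbit \<eta> (Suc k div 2) \<noteq> orbit \<eta> 0"
      using mirror[of "k div 2" 0] return[of "Suc k div 2" 0] h by auto
    then have "pos_breakpoint \<eta> k \<noteq> 1" by (auto simp: pos_breakpoint_def)
    moreover have "pos_breakpoint \<eta> k \<le> 1"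
      using bounds(4)[OF h(1)] bounds(3)[OF h(2)] by (simp add: pos_breakpoint_def)
    ultimately show "pos_breakpoint \<eta> k < 1" by simp
  qed
  have inj: "inj_on (pos_breakpoint \<eta>) {..<2 * N + 1}"
  proof (rule inj_onI)
    fix k l assume kl: "k \<in> {..<2 * N + 1}" "l \<in> {..<2 * N + 1}" and eq: "pos_breakpoint \<eta> k = pos_breakpoint \<eta> l"
    then have h: "k div 2 \<le> N" "odd k \<Longrightarrow> Suc k div 2 \<le> N" "l div 2 \<le> N" "odd l \<Longrightarrow> Suc l div 2 \<le> N"
      by (auto elim!: oddE)
    show "k = l"
    proof (cases "even k"; cases "even l")
      assume "even k" "even l"
      then have "orbit \<eta> (k div 2) = orbit \<eta> (l div 2)" using eq by (simp add: pos_breakpoint_def)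
      then have "k div 2 = l div 2" using return h by blast
      then show ?thesis using \<open>even k\<close> \<open>even l\<close> by (metis dvd_mult_div_cancel)
    next
      assume "even k" "odd l"
      then show ?thesis using eq mirror[of "k div 2" "Suc l div 2"] h by (simp add: pos_breakpoint_def)
    next
      assume "odd k" "even l"
      then show ?thesis using eq mirror[of "l div 2" "Suc k div 2"] h by (simp add: pos_breakpoint_def)
    next
      assume "odd k" "odd l"
      then have "orbit \<eta> (Suc k div 2) = orbit \<eta> (Suc l div 2)" using eq by (simp add: pos_breakpoint_def)
      then have "Suc k div 2 = Suc l div 2" using return h \<open>odd k\<close> \<open>odd l\<close> by blast
      then show ?thesis using \<open>odd k\<close> \<open>odd l\<close> by (auto elim!: oddE)
    qed
  qed
  have range: "-1 < breakpoint N i \<eta> \<and> breakpoint N i \<eta> < 1" if "i < 4 * N + 2" for i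
  proof (cases "i < 2 * N + 1")
    case True
    then show ?thesis using pos[of i] by (simp add: breakpoint_def)
  next
    case False
    then have "i - (2 * N + 1) < 2 * N + 1" using that by linarith
    then show ?thesis using pos[of "i - (2 * N + 1)"] False by (simp add: breakpoint_def)
  qed
  have "inj_on (\<lambda>i. breakpoint N i \<eta>) {..<4 * N + 2}"
  proof (rule inj_onI)
    fix i k assume ik: "i \<in> {..<4 * N + 2}" "k \<in> {..<4 * N + 2}" and eq: "breakpoint N i \<eta> = breakpoint N k \<eta>"
    have sign: "0 < breakpoint N j \<eta> \<longleftrightarrow> j < 2 * N + 1" if "j < 4 * N + 2" for j
      using pos(1)[of j] pos(1)[of "j - (2 * N + 1)"] that
      by (cases "j < 2 * N + 1") (auto simp: breakpoint_def not_less less_imp_le)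
    have "i < 2 * N + 1 \<longleftrightarrow> k < 2 * N + 1"
      using sign[of i] sign[of k] ik eq by simp
    then consider "i < 2 * N + 1" "k < 2 * N + 1" | "\<not> i < 2 * N + 1" "\<not> k < 2 * N + 1" by blast
    then show "i = k"
    proof cases
      case 1
      then show ?thesis using eq inj by (auto simp: breakpoint_def inj_on_def)
    next
      case 2
      then have "pos_breakpoint \<eta> (i - (2 * N + 1)) = pos_breakpoint \<eta> (k - (2 * N + 1))"
        using eq by (simp add: breakpoint_def)
      moreover have "i - (2 * N + 1) \<in> {..<2 * N + 1}" "k - (2 * N + 1) \<in> {..<2 * N + 1}"
        using 2 ik by auto
      ultimately have "i - (2 * N + 1) = k - (2 * N + 1)" using inj_onD[OF inj] by blast
      then show ?thesis using 2 by linarith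
    qed
  qed
  moreover have "{breakpoint N i \<eta> | i. i < 4 * N + 2} \<inter> {-1<..<1} = (\<lambda>i. breakpoint N i \<eta>) ` {..<4 * N + 2}"
    using range by auto
  ultimately show ?thesis by (simp add: card_image)
qed

lemma jumps_on_matching_interval:
  assumes J: "J \<in> components matching_set"
  shows "\<exists>(N::nat) (p :: nat \<Rightarrow> real \<Rightarrow> real) (c::real).
         (\<forall>i<N. continuous_on J (p i)) \<and>
         (\<forall>\<eta>\<in>J. piecewise_smooth_density (inv_measure \<eta>) ({p i \<eta> | i. i < N} \<inter> {-1<..<1})) \<and>
         (\<forall>\<eta>\<in>J - {c}. card ({p i \<eta> | i. i < N} \<inter> {-1<..<1}) = N)"
proof -
  obtain \<eta>0 where \<eta>0: "\<eta>0 \<in> J" "\<eta>0 \<in> matching_set"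
    using in_components_nonempty[OF J] in_components_subset[OF J] by blast
  then obtain n where n: "1 < \<eta>0" "\<eta>0 \<le> 2" "first_entry \<eta>0 n"
    by (auto simp: matching_set_iff)
  define e where "e j = d1 (orbit \<eta>0 j)" for j
  have J_eq: "J = param_cylinder e n"
    using components_matching_set[OF J \<eta>0(1)] same_initial_digits_eq_cylinder[OF n]
    unfolding e_def[abs_def] by simp
  have on_J: "1 < \<eta>" "\<eta> \<le> 2" "first_entry \<eta> n" "\<And>j. j \<le> n \<Longrightarrow> orbit \<eta> j = digit_orbit e j \<eta>"
    if "\<eta> \<in> J" for \<eta>
  proof -
    have e: "\<forall>j<n. e j \<in> {0, 1}" "e n = 1" using digits_before_entry[OF n] by (auto simp: e_def)
    show "1 < \<eta>" "\<eta> \<le> 2" using that by (auto simp: J_eq param_cylinder_def)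
    show "first_entry \<eta> n" "\<And>j. j \<le> n \<Longrightarrow> orbit \<eta> j = digit_orbit e j \<eta>"
      using param_cylinderD[of \<eta> e n] that e by (auto simp: J_eq intro!: orbit_eq_digit_orbit)
  qed
  have orbit_cont: "continuous_on J (\<lambda>\<eta>. orbit \<eta> j)" if "j \<le> n" for j
    using continuous_on_digit_orbit[of J e j] on_J(4) that by (subst continuous_on_cong) auto
  have pos_cont: "continuous_on J (\<lambda>\<eta>. pos_breakpoint \<eta> k)" if "k < 2 * n + 1" for k
  proof (cases "even k")
    case True
    have "k div 2 \<le> n" using that by linarith
    then show ?thesis
      unfolding pos_breakpoint_def using True by (auto intro!: continuous_intros orbit_cont)
  next
    case False
    then have "Suc k div 2 \<le> n" using that by (auto elim!: oddE)
    then show ?thesis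
      unfolding pos_breakpoint_def using False by (auto intro!: continuous_intros orbit_cont)
  qed
  have cont: "continuous_on J (breakpoint n i)" if "i < 4 * n + 2" for i
  proof (cases "i < 2 * n + 1")
    case True
    then show ?thesis unfolding breakpoint_def by (auto intro!: pos_cont)
  next
    case False
    then show ?thesis
      unfolding breakpoint_def using that by (auto intro!: continuous_on_minus pos_cont)
  qed
  obtain s where s: "\<forall>\<eta>. digit_orbit e n \<eta> = 2 ^ n - s * \<eta>"
    using digit_orbit_affine by blast
  \<comment> \<open>The solution of y(n) = \<eta>/2, that is, of 2^n - s \<eta> = \<eta>/2.\<close>
  define c where "c = 2 ^ n / (s + 1 / 2)"
  have c: "orbit \<eta> n \<noteq> \<eta> / 2" if "\<eta> \<in> J - {c}" for \<eta>
  proof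
    assume "orbit \<eta> n = \<eta> / 2"
    then have "(s + 1 / 2) * \<eta> = 2 ^ n"
      using on_J(4)[of \<eta> n] that s by (simp add: algebra_simps)
    moreover from this have "s + 1 / 2 \<noteq> 0" by (metis mult_zero_left power_not_zero zero_neq_numeral)
    ultimately have "\<eta> = c" by (simp add: c_def eq_divide_eq mult.commute)
    then show False using that by simp
  qed
  show ?thesis
  proof (intro exI[of _ "4 * n + 2"] exI[of _ "breakpoint n"] exI[of _ c] conjI allI impI ballI)
    fix \<eta> assume "\<eta> \<in> J"
    then show "piecewise_smooth_density (inv_measure \<eta>) ({breakpoint n i \<eta> | i. i < 4 * n + 2} \<inter> {-1<..<1})"
      using piecewise_smooth_inv_density[of \<eta> n] inv_measure_first_entry[of \<eta> n] on_J
      unfolding breakpoint_image by simp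
  next
    fix \<eta> assume "\<eta> \<in> J - {c}"
    then show "card ({breakpoint n i \<eta> | i. i < 4 * n + 2} \<inter> {-1<..<1}) = 4 * n + 2"
      using card_breakpoint[of \<eta> n] on_J[of \<eta>] c by blast
  qed (rule cont)
qed

section \<open>The exceptional set has measure zero\<close>

text \<open>
  Up to multiples of \<eta> the orbit of 1 is 2^n, and it stays in [0, \<eta>) up to the first visit to the
  gap.
\<close>
lemma orbit_eq_frac:
  assumes \<eta>: "1 < \<eta>" "\<eta> \<le> 2" and "\<forall>j<n. \<not> in_gap \<eta> j"
  shows "frac (2 ^ n / \<eta>) = orbit \<eta> n / \<eta>"
proof -
  obtain k :: int where k: "orbit \<eta> n = 2 ^ n - of_int k * \<eta>"
  proof -
    have "\<exists>k::int. orbit \<eta> n = 2 ^ n - of_int k * \<eta>"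
    proof (induction n)
      case 0
      show ?case by (auto intro: exI[of _ 0])
    next
      case (Suc n)
      then obtain k :: int where "orbit \<eta> n = 2 ^ n - of_int k * \<eta>" by blast
      then show ?case
        by (intro exI[of _ "2 * k + d1 (orbit \<eta> n)"]) (simp add: orbit_Suc sym_doubling_def algebra_simps)
    qed
    then show ?thesis using that by blast
  qed
  have "2 ^ n / \<eta> - orbit \<eta> n / \<eta> = of_int k"
    using k \<eta> by (simp add: field_simps)
  moreover have "0 \<le> orbit \<eta> n" "orbit \<eta> n < \<eta>"
    using orbits_before_gap[OF assms] \<eta> by auto
  ultimately show ?thesis
    using \<eta> by (subst frac_unique_iff) auto
qed

lemma not_matching_frac_bounds:
  assumes \<eta>: "1 < \<eta>" "\<eta> \<le> 2" and "\<eta> \<notin> matching_set"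
  shows "1 - 1 / \<eta> \<le> frac (2 ^ n / \<eta>) \<and> frac (2 ^ n / \<eta>) \<le> 1 / \<eta>"
proof -
  have no: "\<forall>j<n. \<not> in_gap \<eta> j"
    using assms first_entry_exists unfolding matching_set_iff by metis
  then have "frac (2 ^ n / \<eta>) = orbit \<eta> n / \<eta>" "\<eta> - 1 \<le> orbit \<eta> n" "orbit \<eta> n \<le> 1"
    using orbit_eq_frac[OF \<eta> no] orbits_before_gap[OF \<eta> no] by auto
  then show ?thesis
    using \<eta> by (simp add: field_simps)
qed

lemma frac_add_of_int: "frac (x + of_int k) = frac (x::real)"
  by (simp add: frac_def)

lemma frac_mult_frac: "frac (of_nat m * frac x) = frac (of_nat m * (x::real))"
proof -
  have "of_nat m * x - of_nat m * frac x = of_int (int m * \<lfloor>x\<rfloor>)"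
    by (simp add: frac_def algebra_simps)
  then have "of_nat m * frac x = of_nat m * x + of_int (- (int m * \<lfloor>x\<rfloor>))"
    by simp
  then show ?thesis
    by (simp only: frac_add_of_int)
qed

text \<open>
  Let u be the fractional part at the first visit to the gap. The gap is the set where
  1/\<eta> < 2 u < 2 - 1/\<eta>, so the next fractional part, 2 u or 2 u - 1, leaves [1 - 1/\<eta>, 1/\<eta>].
\<close>
lemma not_matchingI:
  assumes \<eta>: "1 < \<eta>" "\<eta> \<le> 2"
    and frac: "\<And>n. 1 - 1 / \<eta> \<le> frac (2 ^ n / \<eta>) \<and> frac (2 ^ n / \<eta>) \<le> 1 / \<eta>"
  shows "\<eta> \<notin> matching_set"
proof
  assume "\<eta> \<in> matching_set"
  then obtain N where N: "first_entry \<eta> N" by (auto simp: matching_set_iff)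
  define u where "u = frac (2 ^ N / \<eta>)"
  have "u = orbit \<eta> N / \<eta>"
    using orbit_eq_frac[OF \<eta>, of N] N by (simp add: first_entry_def u_def)
  then have gap: "1 / \<eta> < 2 * u" "2 * u - 1 < 1 - 1 / \<eta>"
    using N \<eta> by (auto simp: first_entry_def in_gap_def field_simps)
  have "frac (2 ^ Suc N / \<eta>) = frac (2 * u)"
    using frac_mult_frac[of 2 "2 ^ N / \<eta>"] by (simp add: u_def)
  moreover have "frac (2 * u) = (if u < 1 / 2 then 2 * u else 2 * u - 1)"
    using frac_lt_1[of "2 ^ N / \<eta>"] frac_ge_0[of "2 ^ N / \<eta>"]
    by (subst frac_unique_iff) (auto simp: u_def)
  ultimately show False
    using frac[of "Suc N"] gap by (auto split: if_splits)
qed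

text \<open>
  The set is periodic and forward invariant under doubling, so it is null or of full measure; it misses
  the interval (1 - 1 / 2^k, 1).
\<close>
lemma frac_orbit_bounded_away_null:
  "{x::real. \<forall>n. frac (2 ^ n * x) \<le> 1 - 1 / 2 ^ k} \<in> null_sets lborel" (is "?Q \<in> _")
proof -
  have Q [measurable]: "?Q \<in> sets borel"
    unfolding frac_def by measurable
  have per: "x + 1 \<in> ?Q \<longleftrightarrow> x \<in> ?Q" for x
  proof -
    have "frac (2 ^ n * (x + 1)) = frac (2 ^ n * x)" for n
      using frac_add_of_int[of "2 ^ n * x" "2 ^ n"] by (simp add: algebra_simps)
    then show ?thesis by simp
  qed
  have dbl: "AE x in lborel. x \<in> ?Q \<longrightarrow> 2 * x \<in> ?Q"
  proof (intro AE_I2 impI CollectI allI)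
    fix x :: real and n assume "x \<in> ?Q"
    then have "frac (2 ^ Suc n * x) \<le> 1 - 1 / 2 ^ k" by blast
    then show "frac (2 ^ n * (2 * x)) \<le> 1 - 1 / 2 ^ k" by (simp add: algebra_simps)
  qed
  have "\<not> (AE x in lborel. x \<in> ?Q)"
  proof
    assume "AE x in lborel. x \<in> ?Q"
    then have "AE x in lborel. x \<notin> {1 - 1 / 2 ^ k<..<1::real}"
    proof eventually_elim
      case (elim x)
      show ?case
      proof
        assume x: "x \<in> {1 - 1 / 2 ^ k<..<1}"
        have "(0::real) \<le> 1 - 1 / 2 ^ k" by simp
        also have "\<dots> < x" using x by simp
        finally have "frac x = x" using x by (intro frac_eq_id) simp
        moreover have "frac (2 ^ 0 * x) \<le> 1 - 1 / 2 ^ k" using elim by blast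
        ultimately show False using x by simp
      qed
    qed
    then have "emeasure lborel {1 - 1 / 2 ^ k<..<1::real} = 0"
      by (subst (asm) AE_iff_measurable[of "{1 - 1 / 2 ^ k<..<1::real}"]) auto
    then show False by simp
  qed
  then have "AE x in lborel. x \<notin> ?Q"
    using periodic_doubling_zero_one[OF Q _ per dbl] by auto
  then show ?thesis
    by (subst (asm) AE_iff_null) (use Q in auto)
qed

text \<open>
  For \<eta> > 1 the orbit of 1/\<eta> under doubling is bounded by 1/\<eta> < 1, and inversion preserves null sets.
\<close>
lemma not_matching_null: "{1..2} - matching_set \<in> null_sets lborel"
proof -
  let ?Q = "\<lambda>k. {x::real. \<forall>n. frac (2 ^ n * x) \<le> 1 - 1 / 2 ^ k}"
  obtain U where U: "open U" "matching_set = U \<inter> {1..2}" by (rule matching_set_open)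
  have "{1..2} - matching_set = {1..2} - U" using U(2) by auto
  then have borel: "{1..2} - matching_set \<in> sets lborel" using U(1) by simp
  have "negligible (?Q k)" for k
    using frac_orbit_bounded_away_null[of k] by (simp add: negligible_iff_null_sets null_sets_completionI)
  then have neg: "negligible ((\<lambda>t. 1 / t) ` (?Q k \<inter> {0<..<1}))" for k
    by (intro negligible_differentiable_image_negligible)
       (auto intro: negligible_subset differentiable_on_subset[of _ "{0<..<1}"]
         simp: differentiable_on_def intro!: derivative_intros)
  have "\<eta> \<in> {1} \<union> (\<Union>k. (\<lambda>t. 1 / t) ` (?Q k \<inter> {0<..<1}))" if "\<eta> \<in> {1..2} - matching_set" for \<eta>
  proof (cases "\<eta> = 1")
    case False
    then have \<eta>: "1 < \<eta>" "\<eta> \<le> 2" using that by auto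
    then have "0 < 1 - 1 / \<eta>" by simp
    then obtain k where "(1 / 2) ^ k < 1 - 1 / \<eta>"
      using real_arch_pow_inv[of "1 - 1 / \<eta>" "1 / 2"] by auto
    then have k: "1 / \<eta> \<le> 1 - 1 / 2 ^ k" by (simp add: power_one_over)
    have "1 / \<eta> \<in> ?Q k"
    proof (intro CollectI allI)
      fix n
      have "frac (2 ^ n / \<eta>) \<le> 1 / \<eta>"
        using not_matching_frac_bounds[OF \<eta>] that by blast
      then show "frac (2 ^ n * (1 / \<eta>)) \<le> 1 - 1 / 2 ^ k" using k by simp
    qed
    then have "\<eta> \<in> (\<lambda>t. 1 / t) ` (?Q k \<inter> {0<..<1})"
      using \<eta> by (intro image_eqI[of _ _ "1 / \<eta>"]) auto
    then show ?thesis by blast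
  qed simp
  moreover have "negligible ({1} \<union> (\<Union>k. (\<lambda>t. 1 / t) ` (?Q k \<inter> {0<..<1})))"
    using neg by (intro negligible_Un negligible_countable_Union) auto
  ultimately have "negligible ({1..2} - matching_set)"
    using negligible_subset by blast
  then show ?thesis
    using borel by (simp add: negligible_iff_null_sets null_sets_completion_iff)
qed

section \<open>The exceptional set has Hausdorff dimension one\<close>

text \<open>
  Covering [1, 2] by n intervals of length 1/n costs n powr (1 - s), which tends to 0.
\<close>
lemma hausdorff_measure_above_one:
  fixes E :: "real set"
  assumes E: "E \<subseteq> {1..2}" and s: "1 < s"
  shows "hausdorff_measure s E = 0"
proof -
  have pre: "hausdorff_pre s \<delta> E = 0" if \<delta>: "\<delta> > 0" for \<delta>
  proof -
    have le: "hausdorff_pre s \<delta> E \<le> ennreal (real n powr (1 - s))" if n: "0 < n" "1 / real n \<le> \<delta>" for n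
    proof -
      define U where "U i = (if i < n then {1 + real i / n..1 + (real i + 1) / n} else {})" for i
      have diam: "diameter (U i) = (if i < n then 1 / n else 0)" for i
        using n by (auto simp: U_def diameter_closed_interval field_simps)
      have cover: "E \<subseteq> (\<Union>i. U i)"
      proof
        fix x assume "x \<in> E"
        then have x: "1 \<le> x" "x \<le> 2" using E by auto
        show "x \<in> (\<Union>i. U i)"
        proof (cases "x = 2")
          case True
          then have "x \<in> U (n - 1)" using n by (auto simp: U_def of_nat_diff field_simps)
          then show ?thesis by blast
        next
          case False
          define i where "i = nat \<lfloor>(x - 1) * n\<rfloor>"
          have "0 \<le> (x - 1) * n" "(x - 1) * n < n" using x False n by auto
          then have "real i \<le> (x - 1) * n" "(x - 1) * n < real i + 1" "i < n"
            unfolding i_def by linarith+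
          then have "x \<in> U i" using n by (auto simp: U_def field_simps)
          then show ?thesis by blast
        qed
      qed
      have "hausdorff_pre s \<delta> E \<le> (\<Sum>i. ennreal (diameter (U i) powr s))"
        unfolding hausdorff_pre_def using cover diam n \<delta>
        by (intro Inf_lower CollectI exI[of _ U]) (auto simp: U_def)
      also have "\<dots> = (\<Sum>i<n. ennreal (diameter (U i) powr s))"
        by (intro suminf_finite) (auto simp: diam)
      also have "\<dots> = (\<Sum>i<n. ennreal ((1 / n) powr s))"
        by (intro sum.cong) (auto simp: diam)
      also have "\<dots> = ennreal (real n * (1 / n) powr s)"
        by (simp add: ennreal_mult ennreal_of_nat_eq_real_of_nat)
      also have "real n * (1 / n) powr s = real n powr (1 - s)"
        using n by (simp add: powr_diff powr_divide)
      finally show ?thesis .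
    qed
    have "(\<lambda>n. real n powr (1 - s)) \<longlonglongrightarrow> 0"
      using s by (intro tendsto_neg_powr filterlim_real_sequentially) auto
    then have "(\<lambda>n. ennreal (real n powr (1 - s))) \<longlonglongrightarrow> 0"
      using tendsto_ennrealI by force
    moreover have "eventually (\<lambda>n. hausdorff_pre s \<delta> E \<le> ennreal (real n powr (1 - s))) sequentially"
    proof -
      obtain n0 where n0: "0 < n0" "1 / real n0 < \<delta>"
        using \<delta> by (metis nat_approx_posE of_nat_Suc zero_less_Suc)
      have "hausdorff_pre s \<delta> E \<le> ennreal (real n powr (1 - s))" if "n0 \<le> n" for n
      proof (rule le)
        show "0 < n" using that n0 by simp
        have "1 / real n \<le> 1 / real n0" using that n0 by (intro divide_left_mono) auto
        then show "1 / real n \<le> \<delta>" using n0 by simp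
      qed
      then show ?thesis by (auto simp: eventually_sequentially)
    qed
    ultimately have "hausdorff_pre s \<delta> E \<le> 0"
      by (intro tendsto_lowerbound) auto
    then show ?thesis by simp
  qed
  then show ?thesis
    unfolding hausdorff_measure_def by simp
qed

text \<open>
  A cover of E by sets U(i) pulls back under g to a cover of [0, 1) by sets contained in intervals of
  length 2 C (diameter U(i))^s, and these lengths must add up to at least 1.
\<close>
lemma hausdorff_measure_nonzero_inverse_hoelder:
  fixes g :: "real \<Rightarrow> real"
  assumes g: "\<And>v. v \<in> {0..<1} \<Longrightarrow> g v \<in> E" and C: "C > 0" and s: "s > 0"
    and hoelder: "\<And>v w. v \<in> {0..<1} \<Longrightarrow> w \<in> {0..<1} \<Longrightarrow> \<bar>v - w\<bar> \<le> C * \<bar>g v - g w\<bar> powr s"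
  shows "hausdorff_measure s E \<noteq> 0"
proof -
  have "ennreal (1 / (2 * C)) \<le> hausdorff_pre s 1 E"
    unfolding hausdorff_pre_def
  proof (rule Inf_greatest, elim CollectE exE conjE)
    fix y and U :: "nat \<Rightarrow> real set"
    assume y: "y = (\<Sum>i. ennreal (diameter (U i) powr s))" and cover: "E \<subseteq> (\<Union>i. U i)"
      and U: "\<forall>i. bounded (U i) \<and> diameter (U i) \<le> 1"
    define V where "V i = {v \<in> {0..<1}. g v \<in> U i}" for i
    define c where "c i = (SOME v. v \<in> V i)" for i
    define W where "W i = (if V i = {} then {} else cball (c i) (C * diameter (U i) powr s))" for i
    have VW: "V i \<subseteq> W i" for i
    proof
      fix v assume v: "v \<in> V i"
      then have c: "c i \<in> V i" unfolding c_def by (rule someI)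
      have "\<bar>g (c i) - g v\<bar> \<le> diameter (U i)"
        using diameter_bounded_bound[of "U i" "g (c i)" "g v"] U v c by (simp add: V_def dist_real_def)
      then have "C * \<bar>g (c i) - g v\<bar> powr s \<le> C * diameter (U i) powr s"
        using C s by (intro mult_left_mono powr_mono2) auto
      then have "\<bar>c i - v\<bar> \<le> C * diameter (U i) powr s"
        using hoelder[of "c i" v] v c by (simp add: V_def)
      then show "v \<in> W i" using v by (auto simp: W_def dist_real_def)
    qed
    have W [measurable]: "W i \<in> sets lborel" for i by (simp add: W_def)
    have "1 = emeasure lborel {0..<1::real}" by simp
    also have "\<dots> \<le> emeasure lborel (\<Union>i. W i)"
    proof (rule emeasure_mono)
      have "{0..<1} \<subseteq> (\<Union>i. V i)" using g cover by (force simp: V_def)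
      then show "{0..<1} \<subseteq> (\<Union>i. W i)" using VW by blast
      show "(\<Union>i. W i) \<in> sets lborel" using W by blast
    qed
    also have "\<dots> \<le> (\<Sum>i. emeasure lborel (W i))"
      by (rule emeasure_subadditive_countably) (use W in blast)
    also have "\<dots> \<le> (\<Sum>i. ennreal (2 * C) * ennreal (diameter (U i) powr s))"
    proof (rule suminf_le)
      show "emeasure lborel (W i) \<le> ennreal (2 * C) * ennreal (diameter (U i) powr s)" for i
        using C by (simp add: W_def cball_eq_atLeastAtMost ennreal_mult[symmetric])
    qed auto
    also have "\<dots> = ennreal (2 * C) * y" unfolding y by simp
    finally have "ennreal (1 / (2 * C)) * 1 \<le> ennreal (1 / (2 * C)) * (ennreal (2 * C) * y)"
      by (intro mult_left_mono) auto
    also have "\<dots> = y"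
      using C by (simp add: mult.assoc[symmetric] ennreal_mult[symmetric])
    finally show "ennreal (1 / (2 * C)) \<le> y" by simp
  qed
  moreover have "hausdorff_pre s 1 E \<le> hausdorff_measure s E"
    unfolding hausdorff_measure_def by (rule SUP_upper) simp
  moreover have "0 < ennreal (1 / (2 * C))" using C by simp
  ultimately show ?thesis by (metis not_le order_trans)
qed

text \<open>
  The number whose digits in base 4 b, with b = 2^q, are b plus the digits of v in base b. In binary, each block
  of q digits of v is preceded by the digits 01, so no run of equal digits is longer than q + 1.
\<close>
definition sparse_expansion :: "nat \<Rightarrow> real \<Rightarrow> real" where
  "sparse_expansion q v = (\<Sum>j. (2 ^ q + of_int \<lfloor>2 ^ q * frac ((2 ^ q) ^ j * v)\<rfloor>) / (4 * 2 ^ q) ^ Suc j)"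

context
  fixes q :: nat
begin

abbreviation (input) "b \<equiv> (2 ^ q :: real)"
abbreviation (input) "X \<equiv> sparse_expansion q"

lemma sparse_digit_bounds: "0 \<le> \<lfloor>b * frac x\<rfloor>" "real_of_int \<lfloor>b * frac x\<rfloor> \<le> b - 1"
proof -
  show "0 \<le> \<lfloor>b * frac x\<rfloor>" by simp
  have "b * frac x < b * 1" using frac_lt_1[of x] by (intro mult_strict_left_mono) auto
  then have "\<lfloor>b * frac x\<rfloor> < 2 ^ q" by (simp add: floor_less_iff)
  then have "\<lfloor>b * frac x\<rfloor> \<le> 2 ^ q - 1" by simp
  then have "real_of_int \<lfloor>b * frac x\<rfloor> \<le> real_of_int (2 ^ q - 1)" by (rule of_int_le_iff[THEN iffD2])
  then show "real_of_int \<lfloor>b * frac x\<rfloor> \<le> b - 1" by simp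
qed

lemma sparse_expansion_sums:
  "(\<lambda>j. (b + of_int \<lfloor>b * frac (b ^ j * v)\<rfloor>) / (4 * b) ^ Suc j) sums X v" (is "?f sums _")
  and sparse_expansion_bounds: "1 / 4 \<le> X v" "X v \<le> 1 / 2"
proof -
  have b: "1 \<le> b" by simp
  have nonneg: "0 \<le> ?f j" for j
    using sparse_digit_bounds(1)[of "b ^ j * v"] b by (intro divide_nonneg_nonneg) auto
  have le: "?f j \<le> (2 * b - 1) * (1 / (4 * b)) * (1 / (4 * b)) ^ j" for j
  proof -
    have "?f j \<le> (2 * b - 1) / (4 * b) ^ Suc j"
      using sparse_digit_bounds(2)[of "b ^ j * v"] b by (intro divide_right_mono) auto
    then show ?thesis by (simp add: power_one_over field_simps)
  qed
  have "1 < 4 * b" using b by linarith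
  then have lt: "norm (1 / (4 * b)) < 1" by simp
  have geo: "(\<lambda>j. (2 * b - 1) * (1 / (4 * b)) * (1 / (4 * b)) ^ j) sums
             ((2 * b - 1) * (1 / (4 * b)) * (1 / (1 - 1 / (4 * b))))"
    by (intro sums_mult geometric_sums lt)
  have summable: "summable ?f"
    by (rule summable_comparison_test'[OF sums_summable[OF geo], of 0]) (use nonneg le in auto)
  then show sums: "?f sums X v"
    unfolding sparse_expansion_def by (rule summable_sums)
  have "1 / 4 \<le> ?f 0"
    using sparse_digit_bounds(1)[of v] b by (simp add: field_simps)
  also have "\<dots> \<le> X v"
    using sum_le_suminf[OF summable, of "{0}"] nonneg sums_unique[OF sums] by simp
  finally show "1 / 4 \<le> X v" .
  have "X v \<le> (2 * b - 1) * (1 / (4 * b)) * (1 / (1 - 1 / (4 * b)))"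
    by (rule sums_le[OF le sums geo])
  also have "1 - 1 / (4 * b) = (4 * b - 1) / (4 * b)" using b by (simp add: field_simps)
  also have "(2 * b - 1) * (1 / (4 * b)) * (1 / ((4 * b - 1) / (4 * b))) = (2 * b - 1) / (4 * b - 1)"
    by simp
  also have "\<dots> \<le> 1 / 2"
    using b by (subst pos_divide_le_eq) (linarith, simp add: algebra_simps)
  finally show "X v \<le> 1 / 2" .
qed

lemma sparse_expansion_step:
  "X v = (b + of_int \<lfloor>b * frac v\<rfloor> + X (frac (b * v))) / (4 * b)"
proof -
  let ?f = "\<lambda>v j. (b + of_int \<lfloor>b * frac (b ^ j * v)\<rfloor>) / (4 * b) ^ Suc j"
  have "?f v (Suc j) = ?f (frac (b * v)) j / (4 * b)" for j
  proof -
    have "frac (b ^ j * frac (b * v)) = frac (b ^ Suc j * v)"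
      using frac_mult_frac[of "(2 ^ q) ^ j" "b * v"] by (simp add: mult_ac)
    then show ?thesis by simp
  qed
  then have "(\<lambda>j. ?f v (Suc j)) sums (X (frac (b * v)) / (4 * b))"
    using sums_divide[OF sparse_expansion_sums] by presburger
  then have "?f v sums (X (frac (b * v)) / (4 * b) + ?f v 0)"
    by (rule sums_Suc)
  then have "X v = X (frac (b * v)) / (4 * b) + ?f v 0"
    using sparse_expansion_sums sums_unique2 by blast
  then show ?thesis by (simp add: add_divide_distrib)
qed

lemma frac_power_sparse_expansion: "\<exists>w. frac ((4 * b) ^ j * X v) = X w"
proof (induction j)
  case 0
  have "X v \<in> {0..<1}" using sparse_expansion_bounds[of v] by simp
  then have "frac (X v) = X v" by (rule frac_eq_id)
  then show ?case by auto
next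
  case (Suc j)
  then obtain w where w: "frac ((4 * b) ^ j * X v) = X w" by blast
  have "frac ((4 * b) ^ Suc j * X v) = frac (of_nat (4 * 2 ^ q) * ((4 * b) ^ j * X v))"
    by (simp add: mult_ac)
  also have "\<dots> = frac (of_nat (4 * 2 ^ q) * frac ((4 * b) ^ j * X v))"
    by (rule frac_mult_frac[symmetric])
  also have "\<dots> = frac (4 * b * X w)"
    unfolding w by simp
  also have "4 * b * X w = X (frac (b * w)) + of_int (2 ^ q + \<lfloor>b * frac w\<rfloor>)"
    by (subst sparse_expansion_step) simp
  also have "frac \<dots> = frac (X (frac (b * w)))" by (rule frac_add_of_int)
  also have "\<dots> = X (frac (b * w))"
    using sparse_expansion_bounds[of "frac (b * w)"] by (intro frac_eq_id) simp
  finally show ?case by blast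
qed

text \<open>
  After at most q + 2 further doublings every point of the orbit reaches the start of a block, hence
  a point of [1/4, 1/2]. A point within 1 / 2^(q + 4) of 0 or 1 is still within 1/4 of 0 or 1
  after these doublings, on the same side.
\<close>
lemma frac_doubling_sparse_expansion:
  "1 / 2 ^ (q + 4) \<le> frac (2 ^ n * X v) \<and> frac (2 ^ n * X v) \<le> 1 - 1 / 2 ^ (q + 4)"
proof -
  define p where "p = q + 2"
  define i where "i = p - n mod p"
  define u where "u = frac (2 ^ n * X v)"
  have p: "4 * b = 2 ^ p" "p > 0" "(2::real) ^ (q + 4) = 4 * 2 ^ p" by (simp_all add: p_def power_add)
  have i: "i \<le> p" "i + n = p * Suc (n div p)"
  proof -
    have "n mod p < p" using p(2) by simp
    moreover have "p * (n div p) + n mod p = n" by simp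
    ultimately show "i \<le> p" "i + n = p * Suc (n div p)"
      unfolding i_def by (simp_all only: mult_Suc_right; linarith)+
  qed
  have "(2::real) ^ i * 2 ^ n = (4 * b) ^ Suc (n div p)"
    by (simp only: power_add[symmetric] i(2) p(1) power_mult)
  then have "frac (2 ^ i * u) = frac ((4 * b) ^ Suc (n div p) * X v)"
    using frac_mult_frac[of "2 ^ i" "2 ^ n * X v"] by (simp add: u_def mult.assoc[symmetric] del: power_Suc)
  then obtain w where w: "frac (2 ^ i * u) = X w"
    using frac_power_sparse_expansion by metis
  have frac: "1 / 4 \<le> frac (2 ^ i * u)" "frac (2 ^ i * u) \<le> 1 / 2"
    unfolding w by (rule sparse_expansion_bounds)+
  have u: "0 \<le> u" "u < 1" by (simp_all add: u_def frac_lt_1)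
  have ip: "(2::real) ^ i \<le> 2 ^ p" using i(1) by (intro power_increasing) auto
  have "\<not> u < 1 / 2 ^ (q + 4)"
  proof
    assume "u < 1 / 2 ^ (q + 4)"
    then have "2 ^ p * u < 1 / 4" by (simp add: p field_simps)
    then have small: "2 ^ i * u < 1 / 4" using mult_right_mono[OF ip u(1)] by linarith
    then have "frac (2 ^ i * u) = 2 ^ i * u" using u by (intro frac_eq_id) auto
    then show False using frac(1) small by simp
  qed
  moreover have "\<not> 1 - 1 / 2 ^ (q + 4) < u"
  proof
    assume "1 - 1 / 2 ^ (q + 4) < u"
    then have "1 - u < 1 / 2 ^ (q + 4)" by linarith
    then have "2 ^ p * (1 - u) < 1 / 4" by (simp add: p field_simps)
    then have small: "2 ^ i * (1 - u) < 1 / 4"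
      using mult_right_mono[OF ip, of "1 - u"] u(2) by linarith
    have "0 < 2 ^ i * (1 - u)" using u by simp
    then have "frac (2 ^ i * u) = 1 - 2 ^ i * (1 - u)"
      using small by (subst frac_unique_iff) (auto simp: algebra_simps)
    then show False using frac(2) small by simp
  qed
  ultimately show ?thesis by (simp add: u_def not_less)
qed

text \<open>
  Here j is the length of the common prefix of v and w in base b. If the first digits differ, the images
  in base 4 b differ by at least (1 - 1/4) / (4 b), because the tails lie in [1/4, 1/2]. A common first
  digit is removed by passing to the fractional parts of b v and b w. The induction measures by n how
  close v and w are, which bounds the length of the common prefix.
\<close>
lemma sparse_expansion_separates:
  assumes q: "0 < q" and vw: "v \<in> {0..<1}" "w \<in> {0..<1}" "v \<noteq> w"
  shows "\<exists>j. \<bar>v - w\<bar> \<le> 1 / b ^ j \<and> 1 / (8 * b) / (4 * b) ^ j \<le> \<bar>X v - X w\<bar>"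
proof -
  have b: "1 < b" using q by simp
  have main: "\<exists>j. \<bar>v - w\<bar> \<le> 1 / b ^ j \<and> 1 / (8 * b) / (4 * b) ^ j \<le> \<bar>X v - X w\<bar>"
    if "v \<in> {0..<1}" "w \<in> {0..<1}" "1 / b ^ n < \<bar>v - w\<bar>" for n v w
    using that
  proof (induction n arbitrary: v w)
    case 0
    then show ?case by auto
  next
    case (Suc n)
    define v' w' where "v' = frac (b * v)" and "w' = frac (b * w)"
    have fv: "frac v = v" "frac w = w" using Suc.prems by simp_all
    have bv: "b * v = of_int \<lfloor>b * v\<rfloor> + v'" "b * w = of_int \<lfloor>b * w\<rfloor> + w'"
      by (simp_all add: v'_def w'_def frac_def)
    have Xd: "4 * b * (X v - X w) = of_int \<lfloor>b * v\<rfloor> - of_int \<lfloor>b * w\<rfloor> + (X v' - X w')"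
      unfolding sparse_expansion_step[of v] sparse_expansion_step[of w] fv v'_def w'_def
      by (simp add: field_simps)
    have abs: "\<bar>4 * b * (X v - X w)\<bar> = 4 * b * \<bar>X v - X w\<bar>" "\<bar>b * (v - w)\<bar> = b * \<bar>v - w\<bar>"
      using b by (simp_all add: abs_mult)
    show ?case
    proof (cases "\<lfloor>b * v\<rfloor> = \<lfloor>b * w\<rfloor>")
      case True
      have "b * (v - w) = v' - w'" using bv True by (simp add: algebra_simps)
      then have d: "b * \<bar>v - w\<bar> = \<bar>v' - w'\<bar>" using abs by simp
      have "4 * b * (X v - X w) = X v' - X w'" using Xd True by simp
      then have D: "4 * b * \<bar>X v - X w\<bar> = \<bar>X v' - X w'\<bar>" using abs by simp
      have "1 / b ^ n < b * \<bar>v - w\<bar>" using Suc.prems(3) b by (simp add: field_simps)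
      then obtain j where j: "\<bar>v' - w'\<bar> \<le> 1 / b ^ j" "1 / (8 * b) / (4 * b) ^ j \<le> \<bar>X v' - X w'\<bar>"
        using Suc.IH[of v' w'] d by (auto simp: v'_def w'_def frac_lt_1)
      have "b * \<bar>v - w\<bar> \<le> b * (1 / b ^ Suc j)" using j(1) d b by simp
      then have "\<bar>v - w\<bar> \<le> 1 / b ^ Suc j" by (rule mult_left_le_imp_le) (use b in simp)
      moreover have "4 * b * (1 / (8 * b) / (4 * b) ^ Suc j) \<le> 4 * b * \<bar>X v - X w\<bar>"
        using j(2) b unfolding D by simp
      then have "1 / (8 * b) / (4 * b) ^ Suc j \<le> \<bar>X v - X w\<bar>"
        by (rule mult_left_le_imp_le) (use b in simp)
      ultimately show ?thesis by blast
    next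
      case False
      then have "1 \<le> \<bar>\<lfloor>b * v\<rfloor> - \<lfloor>b * w\<rfloor>\<bar>" by linarith
      then have "1 \<le> \<bar>real_of_int \<lfloor>b * v\<rfloor> - real_of_int \<lfloor>b * w\<rfloor>\<bar>"
        by (metis of_int_1_le_iff of_int_abs of_int_diff)
      then have "1 / 2 \<le> \<bar>4 * b * (X v - X w)\<bar>"
        unfolding Xd using sparse_expansion_bounds[of v'] sparse_expansion_bounds[of w'] by linarith
      then have "1 / (8 * b) \<le> \<bar>X v - X w\<bar>" using b unfolding abs by (simp add: field_simps)
      then show ?thesis using Suc.prems by (intro exI[of _ 0]) auto
    qed
  qed
  obtain n where "(1 / b) ^ n < \<bar>v - w\<bar>"
    using real_arch_pow_inv[of "\<bar>v - w\<bar>" "1 / b"] vw(3) b by auto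
  then show ?thesis using main[OF vw(1,2), of n] by (simp add: power_one_over)
qed

text \<open>
  As b = (4 b) powr (q / (q + 2)), the two scales of the separation lemma are related by this exponent.
\<close>
lemma sparse_expansion_inverse_hoelder:
  fixes s :: real
  assumes q: "0 < q" and s: "0 < s" "s * (q + 2) \<le> q" and vw: "v \<in> {0..<1}" "w \<in> {0..<1}"
  shows "\<bar>v - w\<bar> \<le> (8 * b * \<bar>X v - X w\<bar>) powr s"
proof (cases "v = w")
  case False
  then obtain j where j: "\<bar>v - w\<bar> \<le> 1 / b ^ j" "1 / (8 * b) / (4 * b) ^ j \<le> \<bar>X v - X w\<bar>"
    using sparse_expansion_separates[OF q vw] by blast
  have "1 / b ^ j = 2 powr (- (real q * real j))"
    by (simp add: powr_minus_divide powr_realpow[symmetric] powr_powr)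
  also have "\<dots> \<le> 2 powr (- ((real q + 2) * real j) * s)"
    using mult_right_mono[OF s(2), of "real j"] by (intro powr_mono) (auto simp: algebra_simps)
  also have "\<dots> = (2 powr - ((real q + 2) * real j)) powr s"
    by (simp add: powr_powr)
  also have "2 powr - ((real q + 2) * real j) = 1 / (4 * b) ^ j"
  proof -
    have "4 * b = 2 ^ (q + 2)" by simp
    then have "(4 * b) ^ j = 2 ^ ((q + 2) * j)" by (simp only: power_mult)
    also have "\<dots> = 2 powr ((real q + 2) * real j)"
      using powr_realpow[of 2 "(q + 2) * j"] by (simp add: algebra_simps)
    finally show ?thesis by (simp add: powr_minus_divide)
  qed
  also have "(1 / (4 * b) ^ j) powr s \<le> (8 * b * \<bar>X v - X w\<bar>) powr s"
  proof (rule powr_mono2)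
    have "8 * b * (1 / (8 * b) / (4 * b) ^ j) \<le> 8 * b * \<bar>X v - X w\<bar>"
      by (intro mult_left_mono j(2)) simp
    then show "1 / (4 * b) ^ j \<le> 8 * b * \<bar>X v - X w\<bar>" by simp
  qed (use s in auto)
  finally show ?thesis using j(1) by linarith
qed simp

end

text \<open>
  In binary, t is a run of k ones, then a zero, then the digits of x. The orbit of t decreases while the run is
  consumed; afterwards it is the orbit of x, which by assumption keeps a distance of at least 1 / 2^k from 0
  and 1, and this is more than 1 - t.
\<close>
lemma frac_doubling_long_run:
  fixes x :: real
  assumes k: "3 \<le> k" and x: "1 / 4 \<le> x" "x \<le> 1 / 2"
    and bounds: "\<And>n. 1 / 2 ^ k \<le> frac (2 ^ n * x) \<and> frac (2 ^ n * x) \<le> 1 - 1 / 2 ^ k"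
  defines "t \<equiv> 1 - 1 / 2 ^ k + x / 2 ^ Suc k"
  shows "1 - t \<le> frac (2 ^ n * t) \<and> frac (2 ^ n * t) \<le> t"
proof -
  define r where "r = (1 - x / 2) / 2 ^ k"
  have t: "t = 1 - r" by (simp add: t_def r_def diff_divide_distrib)
  have r0: "0 < r" using x by (simp add: r_def)
  have "(2::real) ^ 3 \<le> 2 ^ k" using k by (intro power_increasing) auto
  then have k8: "(8::real) \<le> 2 ^ k" by simp
  have r2: "2 ^ k * r \<le> 7 / 8" using x by (simp add: r_def)
  have "8 * r \<le> 2 ^ k * r" using k8 r0 by (intro mult_right_mono) auto
  then have r: "r \<le> 1 / 8" using r2 by linarith
  show ?thesis
  proof (cases "n \<le> k")
    case True
    have "2 ^ n * r \<le> 2 ^ k * r" using True r0 by (intro mult_right_mono power_increasing) auto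
    then have le: "2 ^ n * r \<le> 7 / 8" using r2 by linarith
    have ge: "r \<le> 2 ^ n * r" using r0 by simp
    have "frac (2 ^ n * t) = 1 - 2 ^ n * r"
      using le ge r0 by (subst frac_unique_iff) (auto simp: t algebra_simps)
    then show ?thesis using le ge r by (simp add: t)
  next
    case False
    then obtain i where n: "n = Suc k + i" using less_iff_Suc_add[of k n] by auto
    have "2 ^ n * t = 2 ^ i * x + of_int (2 ^ n - 2 ^ Suc i)"
      by (simp add: n t_def power_add field_simps)
    then have "frac (2 ^ n * t) = frac (2 ^ i * x)" by (simp only: frac_add_of_int)
    moreover have "r \<le> 1 / 2 ^ k" using x by (simp add: r_def divide_right_mono)
    ultimately show ?thesis using bounds[of i] by (simp add: t)
  qed
qed

text \<open>
  A long run of ones in front of the sparse expansion of v turns it into the inverse of an exceptional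
  parameter, and v depends on this parameter with Hoelder exponent s once q is large.
\<close>
lemma hausdorff_measure_not_matching:
  assumes s: "0 < s" "s < 1"
  shows "hausdorff_measure s ({1..2} - matching_set) \<noteq> 0"
proof -
  \<comment> \<open>This is q / (q + 2) > s, solved for q.\<close>
  obtain q :: nat where "2 * s / (1 - s) < q" using reals_Archimedean2 by blast
  then have q': "2 * s < q * (1 - s)" using s by (simp add: field_simps)
  then have q: "0 < q" using s by (cases q) auto
  have sq: "s * (q + 2) \<le> q" using q' by (simp add: algebra_simps)
  define k where "k = q + 4"
  define X where "X = sparse_expansion q"
  define t where "t v = 1 - 1 / 2 ^ k + X v / 2 ^ Suc k" for v
  have X: "1 / 4 \<le> X v" "X v \<le> 1 / 2" for v
    unfolding X_def by (rule sparse_expansion_bounds)+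
  have t_bounds: "1 / 2 \<le> t v" "t v < 1" for v
  proof -
    have "(2::real) ^ 1 \<le> 2 ^ k" unfolding k_def by (intro power_increasing) auto
    then have "1 / 2 ^ k \<le> (1 / 2 :: real)" by (simp add: field_simps)
    moreover have "0 \<le> X v / 2 ^ Suc k" using X[of v] by simp
    ultimately show "1 / 2 \<le> t v" unfolding t_def by linarith
    have "X v / 2 ^ Suc k < 2 / 2 ^ Suc k" using X[of v] by (intro divide_strict_right_mono) auto
    then show "t v < 1" by (simp add: t_def)
  qed
  show ?thesis
  proof (rule hausdorff_measure_nonzero_inverse_hoelder)
    fix v :: real
    have "1 / t v \<notin> matching_set"
    proof (rule not_matchingI)
      show "1 < 1 / t v" "1 / t v \<le> 2" using t_bounds[of v] by (auto simp: field_simps)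
      fix n
      have "1 - t v \<le> frac (2 ^ n * t v) \<and> frac (2 ^ n * t v) \<le> t v"
        unfolding t_def
        by (rule frac_doubling_long_run)
           (use X frac_doubling_sparse_expansion in \<open>auto simp: k_def X_def\<close>)
      then show "1 - 1 / (1 / t v) \<le> frac (2 ^ n / (1 / t v)) \<and> frac (2 ^ n / (1 / t v)) \<le> 1 / (1 / t v)"
        by simp
    qed
    then show "1 / t v \<in> {1..2} - matching_set" using t_bounds[of v] by (auto simp: field_simps)
  next
    show "0 < (8 * 2 ^ q * 2 ^ Suc k :: real) powr s" by simp
    fix v w :: real assume vw: "v \<in> {0..<1}" "w \<in> {0..<1}"
    \<comment> \<open>Inversion is expanding on (0, 1).\<close>
    have "\<bar>t v - t w\<bar> \<le> \<bar>1 / t v - 1 / t w\<bar>"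
    proof -
      have pos: "0 < t v" "0 < t w" using t_bounds[of v] t_bounds[of w] by linarith+
      have "t v * t w \<le> 1" using t_bounds[of v] t_bounds[of w] by (intro mult_le_one) auto
      then have "\<bar>t v - t w\<bar> * (t v * t w) \<le> \<bar>t v - t w\<bar>" by (intro mult_left_le) auto
      moreover have "\<bar>1 / t v - 1 / t w\<bar> = \<bar>t v - t w\<bar> / (t v * t w)"
        using pos by (simp add: diff_frac_eq abs_minus_commute)
      ultimately show ?thesis using pos by (simp add: pos_le_divide_eq)
    qed
    moreover have "t v - t w = (X v - X w) / 2 ^ Suc k" by (simp add: t_def diff_divide_distrib)
    then have "\<bar>X v - X w\<bar> = 2 ^ Suc k * \<bar>t v - t w\<bar>" by simp
    ultimately have "\<bar>X v - X w\<bar> \<le> 2 ^ Suc k * \<bar>1 / t v - 1 / t w\<bar>"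
      by (simp only:) (intro mult_left_mono; simp)
    then have "8 * 2 ^ q * \<bar>X v - X w\<bar> \<le> 8 * 2 ^ q * (2 ^ Suc k * \<bar>1 / t v - 1 / t w\<bar>)"
      by (intro mult_left_mono) auto
    then have le: "8 * 2 ^ q * \<bar>X v - X w\<bar> \<le> 8 * 2 ^ q * 2 ^ Suc k * \<bar>1 / t v - 1 / t w\<bar>"
      by (simp only: mult.assoc)
    have "\<bar>v - w\<bar> \<le> (8 * 2 ^ q * \<bar>X v - X w\<bar>) powr s"
      unfolding X_def by (rule sparse_expansion_inverse_hoelder[OF q s(1) sq vw])
    also have "\<dots> \<le> (8 * 2 ^ q * 2 ^ Suc k * \<bar>1 / t v - 1 / t w\<bar>) powr s"
      using le s by (intro powr_mono2) auto
    also have "\<dots> = (8 * 2 ^ q * 2 ^ Suc k) powr s * \<bar>1 / t v - 1 / t w\<bar> powr s"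
      by (rule powr_mult)
    finally show "\<bar>v - w\<bar> \<le> (8 * 2 ^ q * 2 ^ Suc k) powr s * \<bar>1 / t v - 1 / t w\<bar> powr s" .
  qed (use s in simp)
qed

lemma hausdorff_dim_not_matching: "hausdorff_dim ({1..2} - matching_set) = 1"
  unfolding hausdorff_dim_def
proof (rule antisym)
  let ?S = "{ereal s | s. 0 < s \<and> hausdorff_measure s ({1..2} - matching_set) = 0}"
  show "Inf ?S \<le> 1"
  proof (rule dense_ge)
    fix y :: ereal assume "1 < y"
    then obtain s where s: "1 < ereal s" "ereal s < y" using ereal_dense2[of 1 y] by auto
    then have "hausdorff_measure s ({1..2} - matching_set) = 0"
      by (intro hausdorff_measure_above_one) auto
    then have "Inf ?S \<le> ereal s" using s by (intro Inf_lower) auto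
    then show "Inf ?S \<le> y" using s(2) by simp
  qed
  show "1 \<le> Inf ?S"
  proof (rule Inf_greatest)
    fix y assume "y \<in> ?S"
    then obtain s where s: "y = ereal s" "0 < s" "hausdorff_measure s ({1..2} - matching_set) = 0" by blast
    then have "\<not> s < 1" using hausdorff_measure_not_matching by blast
    then show "1 \<le> y" using s(1) by simp
  qed
qed

theorem theorem1:
  "({1..2} - \<Union> matching_intervals) \<in> null_sets lborel \<and>
   hausdorff_dim ({1..2} - \<Union> matching_intervals) = 1 \<and>
   disjoint matching_intervals \<and>
   (\<forall>J \<in> matching_intervals.
      is_interval J \<and> interior J \<noteq> {} \<and> J \<subseteq> {1..2} \<and>
      (\<exists>(N::nat) (p :: nat \<Rightarrow> real \<Rightarrow> real) (c::real).
         (\<forall>i<N. continuous_on J (p i)) \<and>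
         (\<forall>\<eta>\<in>J. piecewise_smooth_density (inv_measure \<eta>)
                    ({p i \<eta> | i. i < N} \<inter> {-1<..<1})) \<and>
         (\<forall>\<eta>\<in>J - {c}. card ({p i \<eta> | i. i < N} \<inter> {-1<..<1}) = N)) \<and>
      (\<forall>\<eta>\<in>J. J = {\<eta>' \<in> {1..2}. matching_index \<eta>' < \<infinity> \<and>
                                initial_digits \<eta>' = initial_digits \<eta>}))"
proof (intro conjI ballI)
  show "{1..2} - \<Union> matching_intervals \<in> null_sets lborel"
    unfolding Union_matching_intervals by (rule not_matching_null)
  show "hausdorff_dim ({1..2} - \<Union> matching_intervals) = 1"
    unfolding Union_matching_intervals by (rule hausdorff_dim_not_matching)
  show "disjoint matching_intervals"
    unfolding matching_intervals_def disjoint_def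
    using pairwise_disjoint_components by (auto simp: pairwise_def)
  fix J assume "J \<in> matching_intervals"
  then have J: "J \<in> components matching_set"
    by (simp only: matching_intervals_def matching_set_def)
  show "is_interval J"
    using in_components_connected[OF J] by (simp add: is_interval_connected_1)
  show "interior J \<noteq> {}"
    by (rule interior_matching_interval[OF J])
  show "J \<subseteq> {1..2}"
    using in_components_subset[OF J] by (auto simp: matching_set_def)
  show "\<exists>(N::nat) (p :: nat \<Rightarrow> real \<Rightarrow> real) (c::real).
         (\<forall>i<N. continuous_on J (p i)) \<and>
         (\<forall>\<eta>\<in>J. piecewise_smooth_density (inv_measure \<eta>)
                    ({p i \<eta> | i. i < N} \<inter> {-1<..<1})) \<and>
         (\<forall>\<eta>\<in>J - {c}. card ({p i \<eta> | i. i < N} \<inter> {-1<..<1}) = N)"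
    by (rule jumps_on_matching_interval[OF J])
  fix \<eta> assume "\<eta> \<in> J"
  from components_matching_set[OF J this]
  show "J = {\<eta>' \<in> {1..2}. matching_index \<eta>' < \<infinity> \<and> initial_digits \<eta>' = initial_digits \<eta>}"
    by (simp only: matching_set_def mem_Collect_eq conj_assoc)
qed

end
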